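(* Let $\mathcal{P}:=\{(x,x^2):x\in[0,1]\}$, let $s\in(\frac{11}{13},1]$ and let $\psi:\mathbb{N}\to[0,\infty)$ be any function (not necessarily monotonic). If $\sum_{q=1}^\infty \psi(q)^{s+1}q^{1-s}<\infty$, then $\mathcal{H}^s(\mathscr{S}_2(\psi)\cap\mathcal{P})=0$.
   Context: $\mathcal{H}^s$ denotes the $s$-dimensional Hausdorff measure on $\mathbb{R}^2$. For $\psi:\mathbb{N}\to[0,\infty)$, $\mathscr{S}_2(\psi):=\{(x_1,x_2)\in\mathbb{R}^2:\ \text{there are infinitely many } q\in\mathbb{N} \text{ with } \max_{1\le i\le 2}\|q x_i\|<\psi(q)\}$, where $\|\cdot\|$ denotes the distance to the nearest integer. *)

theory Defs
  imports "HOL-Analysis.Analysis"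
begin

text \<open>
  Hausdorff measure is built as an outer measure on all subsets of a metric space, from
  countable covers of small diameter, without a normalising constant. The case distinction
  gives the usual conventions for \<open>s = 0\<close> (only \<open>s \<ge> 0\<close> is meaningful): the library has
  \<open>0 powr 0 = 0\<close>, whereas a nonempty set has to contribute 1 then.
\<close>

definition diam_pow :: "real \<Rightarrow> 'a::metric_space set \<Rightarrow> ennreal" where
  "diam_pow s U =
     (if U = {} then 0 else if s = 0 then 1 else ennreal (diameter U powr s))"

text \<open>Boundedness is required because \<^const>\<open>diameter\<close> is unspecified on unbounded sets.\<close>

definition hausdorff_premeasure :: "real \<Rightarrow> real \<Rightarrow> 'a::metric_space set \<Rightarrow> ennreal" where
  "hausdorff_premeasure s \<delta> E =
     (INF U \<in> {U :: nat \<Rightarrow> 'a set. E \<subseteq> (\<Union>i. U i) \<and> (\<forall>i. bounded (U i) \<and> diameter (U i) \<le> \<delta>)}.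
        \<Sum>i. diam_pow s (U i))"

definition hausdorff_measure :: "real \<Rightarrow> 'a::metric_space set \<Rightarrow> ennreal" where
  "hausdorff_measure s E = (SUP \<delta> \<in> {0<..}. hausdorff_premeasure s \<delta> E)"

definition nearest_int_dist :: "real \<Rightarrow> real" where
  "nearest_int_dist x = \<bar>x - of_int (round x)\<bar>"

definition simult_approx :: "(nat \<Rightarrow> real) \<Rightarrow> (real ^ 'n::finite) set" where
  "simult_approx \<psi> =
     {x. infinite {q. q \<ge> 1 \<and> (MAX i\<in>UNIV. nearest_int_dist (real q * x $ i)) < \<psi> q}}"

definition parabola_arc :: "(real ^ 2) set" where
  "parabola_arc = {vector [x, x\<^sup>2] | x. x \<in> {0..1}}"

end

theory Submission
  imports Defs
    "HOL-Complex_Analysis.Complex_Analysis"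
    "HOL-Computational_Algebra.Squarefree"
    "HOL-Real_Asymp.Real_Asymp"
begin

text \<open>
  A point of the parabola within \<open>\<psi>(q)/q\<close> of a rational point with denominator \<open>q\<close> produces an
  integer \<open>a\<close> with \<open>\<parallel>a\<^sup>2/q\<parallel> \<lless> \<psi>(q)\<close>, so by a Hausdorff--Cantelli argument everything rests on the
  number of such \<open>a\<close> modulo \<open>q\<close>. One may assume \<open>\<psi>(q) \<ge> q\<^bsup>-2/3\<^esup>\<close>. With \<open>H \<approx> 1/\<psi>(q)\<close>, the Fejer
  kernel bounds the count by \<open>q/H\<close> plus an average of the Gauss sums with frequencies \<open>h < H\<close> modulo
  \<open>q\<close>. Landsberg--Schaar reciprocity turns these into exponential sums \<open>dual_sum H q\<close> in the variable
  \<open>q\<close> whose frequencies are fractions with denominators at most \<open>4H\<close>, so the large sieve bounds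
  their mean square over \<open>q\<close>, for any set of moduli. The expected term \<open>q/H\<close> contributes the series
  of the hypothesis, and the mean square bound makes the contribution of the remainder converge for
  \<open>s > 4/5\<close>.
\<close>

section \<open>Fourier series at an endpoint\<close>

text \<open>The exponent 2/3 is a balance. Raising \<psi>(q) to at least q^(-t) adds the series of
  q^(-t(s+1)+1-s), which converges for s > (2-t)/(1+t). A scale H of size 1/\<psi>(q) then meets
  only moduli q >= H^(1/t), and the term of size H^2 in the large sieve, weighted by q^(-s), is
  summable over the scales for s > 2t/(1+t). The two thresholds coincide at t = 2/3, and their
  common value is 4/5. The obstacle is that \<psi> need not be monotonic: \<psi> cannot be compared
  at neighbouring moduli, so the count is needed at each single q. The remainder there depends on
  \<psi> only through the scale H. It is therefore replaced by its sum over all powers of two H, a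
  series in q that no longer involves \<psi> and whose blocks, one for each H, are mean squares over
  an interval of moduli.\<close>

definition ee :: "real \<Rightarrow> complex" where
  "ee x = cis (2 * pi * x)"

lemma norm_ee [simp]: "norm (ee x) = 1"
  by (simp add: ee_def)

lemma ee_0 [simp]: "ee 0 = 1"
  by (simp add: ee_def)

lemma ee_add: "ee (x + y) = ee x * ee y"
  by (simp add: ee_def cis_mult distrib_left)

lemma ee_of_int [simp]: "ee (of_int n) = 1"
  by (simp add: ee_def cis_multiple_2pi)

lemma ee_of_nat [simp]: "ee (of_nat n) = 1"
  using ee_of_int[of "int n"] by simp

lemma ee_add_of_int [simp]: "ee (x + of_int n) = ee x"
  by (simp add: ee_add)

lemma ee_uminus: "ee (- x) = cnj (ee x)"
  by (simp add: ee_def cis_cnj)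

lemma ee_mult_of_nat: "ee (of_nat n * x) = ee x ^ n"
  by (induction n) (simp_all add: ee_add distrib_right)

lemma ee_conv_exp: "ee x = exp (2 * of_real pi * \<i> * of_real x)"
  by (simp add: ee_def cis_conv_exp algebra_simps)

lemma has_vector_derivative_ee:
  assumes "(f has_real_derivative d) (at x within S)"
  shows "((\<lambda>x. ee (f x)) has_vector_derivative (2 * of_real pi * \<i> * of_real d * ee (f x))) (at x within S)"
proof -
  have "((\<lambda>z. exp (2 * of_real pi * \<i> * z)) has_field_derivative
          (2 * of_real pi * \<i> * exp (2 * of_real pi * \<i> * of_real (f x)))) (at (of_real (f x)))"
    by (auto intro!: derivative_eq_intros)
  moreover have "((\<lambda>x. complex_of_real (f x)) has_vector_derivative of_real d) (at x within S)"
    using assms by (rule has_vector_derivative_of_real)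
  ultimately have "((\<lambda>z. exp (2 * of_real pi * \<i> * z)) \<circ> (\<lambda>x. complex_of_real (f x)) has_vector_derivative
     of_real d * (2 * of_real pi * \<i> * exp (2 * of_real pi * \<i> * of_real (f x)))) (at x within S)"
    by (intro field_vector_diff_chain_within) (auto simp: has_field_derivative_at_within)
  thus ?thesis by (simp add: o_def ee_conv_exp algebra_simps)
qed

lemma continuous_on_ee [continuous_intros]:
  "continuous_on S f \<Longrightarrow> continuous_on S (\<lambda>x. ee (f x))"
  unfolding ee_def by (intro continuous_intros)

text \<open>Uniform approximation by a polynomial costs at most \<epsilon>/2, and one integration by
  parts gains a factor 1/t for the polynomial, whose boundary values and derivative are bounded on
  the interval.\<close>

lemma riemann_lebesgue:
  fixes g :: "real \<Rightarrow> complex"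
  assumes "continuous_on {0..1} g"
  shows "((\<lambda>t. integral {0..1} (\<lambda>x. g x * ee (t * x))) \<longlongrightarrow> 0) at_infinity"
  unfolding Lim_at_infinity
proof (intro allI impI)
  fix \<epsilon> :: real assume "\<epsilon> > 0"
  then obtain p where p: "polynomial_function p" "\<And>x. x \<in> {0..1} \<Longrightarrow> norm (g x - p x) < \<epsilon> / 2"
    using Stone_Weierstrass_polynomial_function[OF compact_Icc assms, of "\<epsilon>/2"] by auto
  obtain p' where p': "polynomial_function p'" "\<And>x. (p has_vector_derivative (p' x)) (at x)"
    using has_vector_derivative_polynomial_function[OF p(1)] by blast
  have cont: "continuous_on S p" "continuous_on S p'" for S
    using p(1) p'(1) by (auto intro: continuous_on_polymonial_function)
  obtain B where B: "\<And>x. x \<in> {0..1} \<Longrightarrow> norm (p' x) \<le> B"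
    using compact_imp_bounded[OF compact_continuous_image[OF cont(2) compact_Icc]]
    unfolding bounded_iff by (metis image_eqI)
  have B0: "B \<ge> 0" using order.trans[OF norm_ge_zero B[of 0]] by simp
  define M where "M = norm (p 0) + norm (p 1) + B"
  have M0: "M \<ge> 0" using B0 by (simp add: M_def)
  have main: "norm (integral {0..1} (\<lambda>x. g x * ee (t * x))) < \<epsilon>" if t: "\<bar>t\<bar> \<ge> M / \<epsilon> + 1" for t
  proof -
    define c where "c = 2 * of_real pi * \<i> * complex_of_real t"
    have t1: "\<bar>t\<bar> > M / \<epsilon>" "t \<noteq> 0" using t M0 \<open>\<epsilon> > 0\<close> by (auto simp: field_simps)
    have c: "c \<noteq> 0" "norm c = 2 * pi * \<bar>t\<bar>" using t1 by (auto simp: c_def norm_mult)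
    have "((\<lambda>x. p' x * (ee (t * x) / c) + p x * ee (t * x)) has_integral
             p 1 * (ee (t * 1) / c) - p 0 * (ee (t * 0) / c)) {0..1}"
    proof (rule fundamental_theorem_of_calculus)
      fix x :: real assume "x \<in> {0..1}"
      have "((\<lambda>x. ee (t * x)) has_vector_derivative c * ee (t * x)) (at x within {0..1})"
        unfolding c_def by (intro has_vector_derivative_ee) (auto intro!: derivative_eq_intros)
      hence 1: "((\<lambda>x. ee (t * x) / c) has_vector_derivative ee (t * x)) (at x within {0..1})"
        using has_vector_derivative_mult_right[of _ _ _ "1 / c"] c by (fastforce simp: field_simps)
      show "((\<lambda>x. p x * (ee (t * x) / c)) has_vector_derivative
              p' x * (ee (t * x) / c) + p x * ee (t * x)) (at x within {0..1})"
        using has_vector_derivative_mult[OF has_vector_derivative_at_within[OF p'(2)] 1]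
        by (simp add: add.commute)
    qed auto
    moreover have int1: "(\<lambda>x. p' x * (ee (t * x) / c)) integrable_on {0..1}"
      by (intro integrable_continuous_real continuous_intros cont) (use c in auto)
    moreover have int2: "(\<lambda>x. p x * ee (t * x)) integrable_on {0..1}"
      by (intro integrable_continuous_real continuous_intros cont)
    ultimately have eq: "integral {0..1} (\<lambda>x. p x * ee (t * x)) =
       p 1 * (ee (t * 1) / c) - p 0 * (ee (t * 0) / c) - integral {0..1} (\<lambda>x. p' x * (ee (t * x) / c))"
      by (simp add: Henstock_Kurzweil_Integration.integral_add has_integral_iff algebra_simps)
    have "norm (integral {0..1} (\<lambda>x. p' x * (ee (t * x) / c))) \<le> B / norm c * (1 - 0)"
      by (rule integral_bound)
         (use B c in \<open>auto simp: norm_mult norm_divide divide_right_mono intro!: continuous_intros cont\<close>)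
    hence "norm (integral {0..1} (\<lambda>x. p x * ee (t * x))) \<le> norm (p 1) / norm c + norm (p 0) / norm c + B / norm c"
      unfolding eq by (intro order.trans[OF norm_triangle_ineq4] add_mono)
                      (auto simp: norm_mult norm_divide)
    also have "\<dots> = M / norm c" by (simp add: M_def add_divide_distrib)
    also have "\<dots> \<le> M / (2 * \<bar>t\<bar>)"
      unfolding c using M0 t1 pi_ge_two by (intro divide_left_mono mult_right_mono mult_pos_pos) auto
    also have "\<dots> < \<epsilon> / 2" using t1 \<open>\<epsilon> > 0\<close> by (simp add: field_simps)
    finally have pb: "norm (integral {0..1} (\<lambda>x. p x * ee (t * x))) < \<epsilon> / 2" .
    have int3: "(\<lambda>x. (g x - p x) * ee (t * x)) integrable_on {0..1}"
      by (intro integrable_continuous_real continuous_intros cont assms)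
    have "norm (integral {0..1} (\<lambda>x. (g x - p x) * ee (t * x))) \<le> \<epsilon> / 2 * (1 - 0)"
      by (rule integral_bound)
         (use p(2) in \<open>auto simp: norm_mult intro!: continuous_intros cont assms less_imp_le\<close>)
    moreover have "integral {0..1} (\<lambda>x. g x * ee (t * x)) =
       integral {0..1} (\<lambda>x. (g x - p x) * ee (t * x)) + integral {0..1} (\<lambda>x. p x * ee (t * x))"
      using int2 int3 by (subst Henstock_Kurzweil_Integration.integral_add [symmetric]) (auto simp: algebra_simps)
    ultimately show ?thesis using pb by (auto intro: norm_triangle_lt)
  qed
  show "\<exists>b. \<forall>x. b \<le> norm x \<longrightarrow> dist (integral {0..1} (\<lambda>xa. g xa * ee (x * xa))) 0 < \<epsilon>"
    using main by (intro exI[of _ "M / \<epsilon> + 1"]) auto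
qed

text \<open>The value \<open>G a = deriv F a\<close> is recorded because it tells whether the zero
  is simple; this is how the denominator in the next lemma is seen not to vanish at 0 and 1.\<close>

lemma entire_factor:
  fixes F :: "complex \<Rightarrow> complex"
  assumes "F holomorphic_on UNIV" "F a = 0"
  obtains G where "G holomorphic_on UNIV" "\<And>z. F z = (z - a) * G z" "G a = deriv F a"
proof
  show "(\<lambda>z. if z = a then deriv F a else (F z - F a) / (z - a)) holomorphic_on UNIV"
    by (rule pole_lemma) (use assms in auto)
qed (use assms in auto)

lemma ee_eq_1_iff: "ee x = 1 \<longleftrightarrow> x \<in> \<int>"
proof
  assume "ee x = 1"
  then obtain n where "Im (2 * of_real pi * \<i> * of_real x) = of_int (2 * n) * pi"
    unfolding ee_conv_exp exp_eq_1 by auto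
  thus "x \<in> \<int>" by auto
qed (auto elim!: Ints_cases)

text \<open>
  Chernoff's argument: dividing \<open>F - F 0\<close> by \<open>ee x - 1\<close> makes the partial sums of the Fourier
  coefficients telescope, and the quotient is continuous because both zeros of \<open>ee x - 1\<close> in
  \<open>[0, 1]\<close> cancel.
\<close>

lemma fourier_sum_at_0:
  fixes F :: "complex \<Rightarrow> complex"
  assumes F: "F holomorphic_on UNIV" and F01: "F 1 = F 0"
  shows "(\<lambda>N. \<Sum>i<2*N. integral {0..1} (\<lambda>x. F (of_real x) * ee (- (real i - real N) * x))) \<longlonglongrightarrow> F 0"
proof -
  obtain G where G: "G holomorphic_on UNIV" "\<And>z. F z - F 0 = (z - 0) * G z"
  proof (rule entire_factor[of "\<lambda>z. F z - F 0" 0])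
    show "(\<lambda>z. F z - F 0) holomorphic_on UNIV" by (intro holomorphic_intros F)
  qed auto
  have "G 1 = 0" using G(2)[of 1] F01 by simp
  then obtain G2 where G2: "G2 holomorphic_on UNIV" "\<And>z. G z = (z - 1) * G2 z"
    using entire_factor[of G 1] G(1) by blast
  define E where "E = (\<lambda>z. exp (2 * of_real pi * \<i> * z) - 1)"
  have E: "E holomorphic_on UNIV" "E 0 = 0" "E 1 = 0"
    by (auto simp: E_def intro!: holomorphic_intros)
  have dE: "(E has_field_derivative 2 * of_real pi * \<i> * exp (2 * of_real pi * \<i> * z)) (at z)" for z
    unfolding E_def by (auto intro!: derivative_eq_intros)
  obtain H where H: "H holomorphic_on UNIV" "\<And>z. E z = (z - 0) * H z" "H 0 = deriv E 0"
    using entire_factor[of E 0] E by blast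
  have "H 1 = 0" using H(2)[of 1] E by simp
  then obtain H2 where H2: "H2 holomorphic_on UNIV" "\<And>z. H z = (z - 1) * H2 z" "H2 1 = deriv H 1"
    using entire_factor[of H 1] H(1) by blast
  have H2_0: "H2 0 \<noteq> 0" using H(3) H2(2)[of 0] dE[of 0, THEN DERIV_imp_deriv] by auto
  \<comment> \<open>Otherwise \<open>E\<close> would have a double zero at 1, but its derivative
    there is 2 pi i.\<close>
  have H2_1: "H2 1 \<noteq> 0"
  proof
    assume *: "H2 1 = 0"
    have "(H has_field_derivative 0) (at 1)"
      using holomorphic_derivI[OF H(1) open_UNIV, of 1] H2(3) * by simp
    hence "((\<lambda>z. (z - 0) * H z) has_field_derivative 0) (at 1)"
      using \<open>H 1 = 0\<close> by (auto intro!: derivative_eq_intros)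
    moreover have "(\<lambda>z. (z - 0) * H z) = E" using H(2) by auto
    ultimately have "(E has_field_derivative 0) (at 1)" by (simp only:)
    from DERIV_unique[OF this dE[of 1]] show False by simp
  qed
  have H2_ne: "H2 (of_real x) \<noteq> 0" if "x \<in> {0..1}" for x
  proof (cases "x = 0 \<or> x = 1")
    case False
    hence "0 < x" "x < 1" using that by auto
    hence "x \<notin> \<int>"
      by (metis Ints_cases of_int_0_less_iff of_int_less_1_iff zless_imp_add1_zle add_0 not_less)
    hence "E (of_real x) \<noteq> 0" using ee_eq_1_iff[of x] unfolding ee_conv_exp E_def by simp
    thus ?thesis unfolding H(2)[of "of_real x"] H2(2)[of "of_real x"] by simp
  qed (use H2_0 H2_1 in auto)
  define g where "g = (\<lambda>x::real. G2 (of_real x) / H2 (of_real x))"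
  have contg: "continuous_on {0..1} g"
    unfolding g_def
    by (intro continuous_on_divide continuous_on_compose2[OF holomorphic_on_imp_continuous_on[OF G2(1)]]
         continuous_on_compose2[OF holomorphic_on_imp_continuous_on[OF H2(1)]] continuous_intros)
       (use H2_ne in auto)
  have geq: "F (of_real x) = F 0 + g x * (ee x - 1)" if "x \<in> {0..1}" for x
  proof -
    have "F (of_real x) - F 0 = of_real x * (of_real x - 1) * G2 (of_real x)" using G(2) G2(2) by simp
    also have "\<dots> = g x * (of_real x * (of_real x - 1) * H2 (of_real x))"
      using H2_ne[OF that] by (simp add: g_def)
    also have "of_real x * (of_real x - 1) * H2 (of_real x) = E (of_real x)"
      using H(2) H2(2) by simp
    finally show ?thesis by (simp add: E_def ee_conv_exp algebra_simps)
  qed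
  define I where "I = (\<lambda>t. integral {0..1} (\<lambda>x. g x * ee (t * x)))"
  have intg: "(\<lambda>x. g x * ee (t * x)) integrable_on {0..1}" for t
    by (intro integrable_continuous_real continuous_intros contg)
  have inte: "((\<lambda>x. ee (- (real i - real N) * x)) has_integral (if i = N then 1 else 0)) {0..1}" for i N :: nat
  proof (cases "i = N")
    case False
    define t where "t = - (real i - real N)"
    define c where "c = 2 * of_real pi * \<i> * complex_of_real t"
    have c: "c \<noteq> 0" using False by (simp add: c_def t_def)
    have "((\<lambda>x. ee (t * x)) has_integral ee (t * 1) / c - ee (t * 0) / c) {0..1}"
    proof (rule fundamental_theorem_of_calculus)
      fix x :: real
      have "((\<lambda>x. ee (t * x)) has_vector_derivative c * ee (t * x)) (at x within {0..1})"
        unfolding c_def by (intro has_vector_derivative_ee) (auto intro!: derivative_eq_intros)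
      thus "((\<lambda>x. ee (t * x) / c) has_vector_derivative ee (t * x)) (at x within {0..1})"
        using has_vector_derivative_mult_right[of _ _ _ "1 / c"] c by (fastforce simp: field_simps)
    qed auto
    moreover have "ee t = 1" unfolding ee_eq_1_iff t_def by simp
    ultimately show ?thesis using False by (simp add: t_def)
  qed (use has_integral_const_real[of "1::complex" 0 1] in simp)
  \<comment> \<open>Multiplying by \<open>ee x - 1\<close> shifts the frequency by one, so each
    coefficient of \<open>F - F 0\<close> is a difference of \<open>I\<close> at consecutive
    integers.\<close>
  have coeff: "integral {0..1} (\<lambda>x. F (of_real x) * ee (- (real i - real N) * x)) =
     F 0 * (if i = N then 1 else 0) + (I (real N - real i + 1) - I (real N - real i))" for i N
  proof -
    have "((\<lambda>x. F 0 * ee (- (real i - real N) * x) +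
        (g x * ee ((real N - real i + 1) * x) - g x * ee ((real N - real i) * x))) has_integral
        (F 0 * (if i = N then 1 else 0) + (I (real N - real i + 1) - I (real N - real i)))) {0..1}"
      unfolding I_def
      by (rule has_integral_add[OF has_integral_mult_right[OF inte] has_integral_diff])
         (rule integrable_integral[OF intg])+
    also have "?this \<longleftrightarrow> ((\<lambda>x. F (of_real x) * ee (- (real i - real N) * x)) has_integral
        (F 0 * (if i = N then 1 else 0) + (I (real N - real i + 1) - I (real N - real i)))) {0..1}"
    proof (rule has_integral_cong)
      fix x :: real assume "x \<in> {0..1}"
      hence F: "F (of_real x) = F 0 + g x * (ee x - 1)" by (rule geq)
      show "F 0 * ee (- (real i - real N) * x) +
        (g x * ee ((real N - real i + 1) * x) - g x * ee ((real N - real i) * x)) =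
        F (of_real x) * ee (- (real i - real N) * x)"
        using ee_add[of "(real N - real i) * x" x] unfolding F by (simp add: algebra_simps)
    qed
    finally show ?thesis by (rule integral_unique)
  qed
  have sumeq: "(\<Sum>i<2*N. integral {0..1} (\<lambda>x. F (of_real x) * ee (- (real i - real N) * x))) =
     F 0 + (I (real N + 1) - I (- real N + 1))" if "N > 0" for N
  proof -
    have "(\<Sum>i<2*N. I (real N - real i + 1) - I (real N - real i)) =
          (\<Sum>i<2*N. I (real N - real i + 1) - I (real N - real (Suc i) + 1))" by simp
    also have "\<dots> = I (real N + 1) - I (- real N + 1)"
      by (subst sum_lessThan_telescope') simp
    finally show ?thesis using that
      unfolding coeff sum.distrib sum_distrib_left[symmetric] by simp
  qed
  have l1: "(\<lambda>N. I (real N + 1)) \<longlonglongrightarrow> 0"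
    using riemann_lebesgue[OF contg] unfolding I_def
    by (rule filterlim_compose) (rule filterlim_at_top_imp_at_infinity, real_asymp)
  have l2: "(\<lambda>N. I (- real N + 1)) \<longlonglongrightarrow> 0"
    using riemann_lebesgue[OF contg] unfolding I_def
    by (rule filterlim_compose) (rule filterlim_at_bot_imp_at_infinity, real_asymp)
  have "(\<lambda>N. F 0 + (I (real N + 1) - I (- real N + 1))) \<longlonglongrightarrow> F 0 + (0 - 0)"
    by (intro tendsto_intros l1 l2)
  moreover have "eventually (\<lambda>N. F 0 + (I (real N + 1) - I (- real N + 1)) =
      (\<Sum>i<2*N. integral {0..1} (\<lambda>x. F (of_real x) * ee (- (real i - real N) * x)))) sequentially"
    using eventually_gt_at_top[of 0] by eventually_elim (use sumeq in simp)
  ultimately show ?thesis by (auto elim: Lim_transform_eventually)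
qed

section \<open>Landsberg--Schaar reciprocity\<close>

text \<open>The integrand has modulus 1, so convergence comes from oscillation alone. Subtracting
  the boundary term of an integration by parts, \<open>ee (t\<^sup>2) / (4 * pi * \<i> * t)\<close>,
  leaves a function with derivative O(1/t^2), which is Cauchy at infinity.\<close>

lemma primitive_ee_square_tendsto:
  assumes \<Phi>: "\<And>t. (\<Phi> has_vector_derivative ee (t\<^sup>2)) (at t)"
  shows "\<exists>l. (\<Phi> \<longlongrightarrow> l) at_top"
proof -
  define c where "c = 4 * of_real pi * \<i>"
  have c: "c \<noteq> 0" "norm c = 4 * pi" by (auto simp: c_def norm_mult)
  define R where "R = (\<lambda>t. \<Phi> t - ee (t\<^sup>2) / (c * of_real t))"
  have R: "(R has_vector_derivative ee (t\<^sup>2) / (c * of_real (t\<^sup>2))) (at t)" if "t > 0" for t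
  proof -
    have "((\<lambda>t. ee (t\<^sup>2)) has_vector_derivative 2 * of_real pi * \<i> * of_real (2 * t) * ee (t\<^sup>2)) (at t)"
      by (rule has_vector_derivative_ee) (auto intro!: derivative_eq_intros)
    moreover have "((\<lambda>t. complex_of_real (1 / t)) has_vector_derivative of_real (- (1 / t\<^sup>2))) (at t)"
      using that by (intro has_vector_derivative_of_real) (auto intro!: derivative_eq_intros simp: power2_eq_square field_simps)
    ultimately have "((\<lambda>t. ee (t\<^sup>2) * complex_of_real (1 / t)) has_vector_derivative
        ee (t\<^sup>2) * of_real (- (1 / t\<^sup>2)) + (2 * of_real pi * \<i> * of_real (2 * t) * ee (t\<^sup>2)) * of_real (1 / t)) (at t)"
      by (rule has_vector_derivative_mult)
    hence "((\<lambda>t. (1 / c) * (ee (t\<^sup>2) * complex_of_real (1 / t))) has_vector_derivative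
        (1 / c) * (ee (t\<^sup>2) * of_real (- (1 / t\<^sup>2)) + (2 * of_real pi * \<i> * of_real (2 * t) * ee (t\<^sup>2)) * of_real (1 / t))) (at t)"
      by (rule has_vector_derivative_mult_right)
    from has_vector_derivative_diff[OF \<Phi> this]
    have "(R has_vector_derivative ee (t\<^sup>2) - (1 / c) * (ee (t\<^sup>2) * of_real (- (1 / t\<^sup>2)) +
        (2 * of_real pi * \<i> * of_real (2 * t) * ee (t\<^sup>2)) * of_real (1 / t))) (at t)"
      by (simp add: R_def)
    also have "ee (t\<^sup>2) - (1 / c) * (ee (t\<^sup>2) * of_real (- (1 / t\<^sup>2)) +
        (2 * of_real pi * \<i> * of_real (2 * t) * ee (t\<^sup>2)) * of_real (1 / t)) = ee (t\<^sup>2) / (c * of_real (t\<^sup>2))"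
      using that c(1) by (simp add: c_def field_simps)
    finally show ?thesis .
  qed
  have bd: "norm (R y - R x) \<le> 1 / x" if "0 < x" "x \<le> y" for x y
  proof (cases "x = y")
    case False
    have "norm (R y - R x) \<le> - 1 / y - - 1 / x"
    proof (rule differentiable_bound_general)
      show "x < y" using that False by simp
      show "continuous_on {x..y} R"
        using that by (intro continuous_at_imp_continuous_on ballI has_vector_derivative_continuous[OF R]) auto
      show "continuous_on {x..y} (\<lambda>t. - 1 / t)" using that by (intro continuous_intros) auto
      fix t assume t: "x < t" "t < y"
      show "(R has_vector_derivative ee (t\<^sup>2) / (c * of_real (t\<^sup>2))) (at t)" using R t that by auto
      show "((\<lambda>t. - 1 / t) has_vector_derivative 1 / t\<^sup>2) (at t)"
        unfolding has_real_derivative_iff_has_vector_derivative [symmetric]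
        using t that by (auto intro!: derivative_eq_intros simp: power2_eq_square)
      have "1 / (4 * pi * t\<^sup>2) \<le> 1 / (1 * t\<^sup>2)"
        using t that pi_ge_two by (intro divide_left_mono mult_right_mono mult_pos_pos) auto
      thus "norm (ee (t\<^sup>2) / (c * of_real (t\<^sup>2))) \<le> 1 / t\<^sup>2"
        by (simp add: norm_divide norm_mult c norm_power)
    qed
    also have "\<dots> \<le> 1 / x" using that by simp
    finally show ?thesis .
  qed (use that in auto)
  have "Cauchy (\<lambda>n. R (real n))"
  proof (rule metric_CauchyI)
    fix e :: real assume e: "e > 0"
    obtain M where M: "real M > 2 / e" using reals_Archimedean2 by blast
    moreover have "2 / e > 0" using e by simp
    ultimately have "real M > 0" by linarith
    hence "M > 0" by simp
    note M = M this
    show "\<exists>M. \<forall>m\<ge>M. \<forall>n\<ge>M. dist (R (real m)) (R (real n)) < e"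
    proof (intro exI allI impI)
      fix m n assume "m \<ge> M" "n \<ge> M"
      have *: "dist (R (real k)) (R (real M)) \<le> 1 / M" if "k \<ge> M" for k
        using bd[of "real M" "real k"] that M by (simp add: dist_norm)
      have "dist (R (real m)) (R (real n)) \<le> 1 / M + 1 / M"
        using *[OF \<open>m \<ge> M\<close>] *[OF \<open>n \<ge> M\<close>] dist_triangle2[of "R (real m)" "R (real n)" "R (real M)"]
        by linarith
      also have "\<dots> < e" using M e by (simp add: field_simps)
      finally show "dist (R (real m)) (R (real n)) < e" .
    qed
  qed
  then obtain l where l: "(\<lambda>n. R (real n)) \<longlonglongrightarrow> l"
    by (auto simp: Cauchy_convergent_iff convergent_def)
  have Rl: "norm (R x - l) \<le> 1 / x" if "x > 0" for x
  proof (rule tendsto_upperbound)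
    show "(\<lambda>n. norm (R x - R (real n))) \<longlonglongrightarrow> norm (R x - l)"
      by (intro tendsto_intros l)
    show "\<forall>\<^sub>F n in sequentially. norm (R x - R (real n)) \<le> 1 / x"
      using eventually_ge_at_top[of "nat \<lceil>x\<rceil>"]
    proof eventually_elim
      case (elim n)
      hence "x \<le> real n" by linarith
      from bd[OF that this] show ?case by (simp add: norm_minus_commute)
    qed
  qed auto
  have "((\<lambda>x. (R x - l) + ee (x\<^sup>2) / (c * of_real x)) \<longlongrightarrow> 0) at_top"
  proof (rule Lim_null_comparison)
    show "\<forall>\<^sub>F x in at_top. norm ((R x - l) + ee (x\<^sup>2) / (c * of_real x)) \<le> 1 / x + 1 / (4 * pi * x)"
      using eventually_gt_at_top[of 0]
    proof eventually_elim
      case (elim x)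
      thus ?case using Rl[OF elim] by (intro order.trans[OF norm_triangle_ineq] add_mono)
          (auto simp: norm_divide norm_mult c)
    qed
    show "((\<lambda>x::real. 1 / x + 1 / (4 * pi * x)) \<longlongrightarrow> 0) at_top" by real_asymp
  qed
  hence "((\<lambda>x. ((R x - l) + ee (x\<^sup>2) / (c * of_real x)) + l) \<longlongrightarrow> 0 + l) at_top"
    by (intro tendsto_intros)
  thus ?thesis by (auto simp: R_def)
qed

text \<open>
  The constant is \<open>exp (\<i> * pi / 4) / sqrt 2\<close>; here it is the Fresnel integral \<open>l1 + l2'\<close> of an entire
  primitive of \<open>exp (2 * pi * \<i> * z\<^sup>2)\<close>, whose value is not needed. Completing the square in the
  Fourier coefficients and splitting the frequencies into residue classes modulo \<open>2 * h\<close>, each class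
  adds up to an integral over a long interval.
\<close>

lemma landsberg_schaar:
  "\<exists>\<kappa>. \<forall>h q::nat. h > 0 \<longrightarrow> q > 0 \<longrightarrow>
     (\<Sum>a<q. ee (real h * real a ^ 2 / real q)) =
     \<kappa> * of_real (sqrt (real q / real h)) * (\<Sum>r<2*h. ee (- (real r ^ 2 * real q / (4 * real h))))"
proof -
  have "(\<lambda>z. exp (2 * of_real pi * \<i> * z\<^sup>2)) holomorphic_on UNIV" by (intro holomorphic_intros)
  then obtain P where P: "\<And>z. (P has_field_derivative exp (2 * of_real pi * \<i> * z\<^sup>2)) (at z)"
    by (rule holomorphic_convex_primitive'[OF convex_UNIV open_UNIV]) auto
  define \<Phi> where "\<Phi> = (\<lambda>t::real. P (of_real t))"
  have \<Phi>: "(\<Phi> has_vector_derivative ee (t\<^sup>2)) (at t)" for t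
    using has_vector_derivative_real_field[OF P[of "of_real t"]] by (simp add: \<Phi>_def ee_conv_exp)
  \<comment> \<open>The integrand is even, so reflecting a primitive gives another one; its limit at
    infinity yields the limit of \<Phi> at minus infinity.\<close>
  have \<Phi>_uminus: "((\<lambda>t. - \<Phi> (- t)) has_vector_derivative ee (t\<^sup>2)) (at t)" for t
  proof -
    have "((\<lambda>t. - P (- t)) has_field_derivative exp (2 * of_real pi * \<i> * z\<^sup>2)) (at z)" for z
      using DERIV_minus[OF DERIV_chain'[OF DERIV_minus[OF DERIV_ident] P[of "- z"]]] by simp
    from has_vector_derivative_real_field[OF this[of "of_real t"]] show ?thesis
      by (simp add: \<Phi>_def ee_conv_exp)
  qed
  obtain l1 where l1: "(\<Phi> \<longlongrightarrow> l1) at_top"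
    using primitive_ee_square_tendsto[OF \<Phi>] by blast
  obtain l2' where "((\<lambda>t. - \<Phi> (- t)) \<longlongrightarrow> l2') at_top"
    using primitive_ee_square_tendsto[OF \<Phi>_uminus] by blast
  from tendsto_minus[OF this] have l2: "(\<Phi> \<longlongrightarrow> - l2') at_bot"
    by (simp add: filterlim_at_bot_mirror)
  have "(\<Sum>a<q. ee (real h * real a ^ 2 / real q)) =
     (l1 + l2') * of_real (sqrt (real q / real h)) * (\<Sum>r<2*h. ee (- (real r ^ 2 * real q / (4 * real h))))"
    if h: "h > 0" and q: "q > 0" for h q :: nat
  proof -
    define \<mu> where "\<mu> = sqrt (real h / real q)"
    define L where "L = \<mu> * real q"
    have \<mu>: "\<mu> > 0" "\<mu>\<^sup>2 = real h / real q" using h q by (auto simp: \<mu>_def)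
    have L: "L > 0" using \<mu> q by (simp add: L_def)
    have inv_\<mu>: "sqrt (real q / real h) = 1 / \<mu>" using h q by (simp add: \<mu>_def real_sqrt_divide)
    \<comment> \<open>The q unit intervals of [0, q] are folded onto [0, 1]: the Gauss sum is the
      value at 0, and a Fourier coefficient unfolds to one integral over [0, q].
      \<open>F 1 = F 0\<close> holds because the difference telescopes to
      \<open>ee (h * q) - 1\<close>.\<close>
    define F where "F = (\<lambda>z. \<Sum>n<q. exp (2 * of_real pi * \<i> * (of_nat h * (of_nat n + z)\<^sup>2 / of_nat q)))"
    have F_real: "F (of_real x) = (\<Sum>n<q. ee (real h * (real n + x)\<^sup>2 / real q))" for x
      by (simp add: F_def ee_conv_exp)
    have F: "F holomorphic_on UNIV" unfolding F_def using q by (intro holomorphic_intros) auto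
    have F0: "F 0 = (\<Sum>a<q. ee (real h * real a ^ 2 / real q))" using F_real[of 0] by simp
    have "F 1 - F 0 = (\<Sum>n<q. ee (real h * real (Suc n) ^ 2 / real q) - ee (real h * real n ^ 2 / real q))"
      using F_real[of 1] F0 by (simp add: sum_subtractf add.commute)
    also have "\<dots> = ee (real h * real q ^ 2 / real q) - 1"
      by (subst sum_lessThan_telescope) simp
    also have "real h * real q ^ 2 / real q = of_nat (h * q)" using q by (simp add: power2_eq_square)
    finally have F01: "F 1 = F 0" by (simp only: ee_of_nat) simp
    \<comment> \<open>Completing the square: h t^2/q - m t = (\<mu> (t - m q/(2h)))^2 - m^2 q/(4h).
      The arguments of \<Phi> are \<mu> (t - m q/(2h)) at t = q and t = 0.\<close>
    define W where "W = (\<lambda>m. ee (- (m\<^sup>2 * real q / (4 * real h))) *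
         (\<Phi> (L * (1 - m / (2 * real h))) - \<Phi> (L * (- m / (2 * real h)))))"
    have coeff: "integral {0..1} (\<lambda>x. F (of_real x) * ee (- m * x)) = of_real (1 / \<mu>) * W m"
      if m: "m \<in> \<int>" for m
    proof -
      define K where "K = (\<lambda>t. (of_real (1 / \<mu>) * ee (- (m\<^sup>2 * real q / (4 * real h)))) * \<Phi> (\<mu> * (t - m * real q / (2 * real h))))"
      have K: "((\<lambda>x. K (real n + x)) has_vector_derivative ee (real h * (real n + x)\<^sup>2 / real q) * ee (- m * x)) (at x within {0..1})" for n x
      proof -
        define y where "y = \<mu> * ((real n + x) - m * real q / (2 * real h))"
        have "((\<lambda>x. \<mu> * ((real n + x) - m * real q / (2 * real h))) has_real_derivative \<mu>) (at x within {0..1})"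
          by (auto intro!: derivative_eq_intros)
        hence "((\<lambda>x. \<mu> * ((real n + x) - m * real q / (2 * real h))) has_vector_derivative \<mu>) (at x within {0..1})"
          by (simp add: has_real_derivative_iff_has_vector_derivative)
        from vector_diff_chain_within[OF this has_vector_derivative_at_within[OF \<Phi>]]
        have "((\<lambda>x. \<Phi> (\<mu> * ((real n + x) - m * real q / (2 * real h)))) has_vector_derivative \<mu> *\<^sub>R ee (y\<^sup>2)) (at x within {0..1})"
          by (simp add: o_def y_def)
        from has_vector_derivative_mult_right[OF this]
        have "((\<lambda>x. K (real n + x)) has_vector_derivative (of_real (1 / \<mu>) * ee (- (m\<^sup>2 * real q / (4 * real h)))) * (\<mu> *\<^sub>R ee (y\<^sup>2))) (at x within {0..1})"
          unfolding K_def .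
        also have "(of_real (1 / \<mu>) * ee (- (m\<^sup>2 * real q / (4 * real h)))) * (\<mu> *\<^sub>R ee (y\<^sup>2)) =
             ee (- (m\<^sup>2 * real q / (4 * real h)) + y\<^sup>2)"
          using \<mu>(1) unfolding ee_add by (simp add: scaleR_conv_of_real)
        also have "- (m\<^sup>2 * real q / (4 * real h)) + y\<^sup>2 = real h * (real n + x)\<^sup>2 / real q - m * (real n + x)"
          unfolding y_def power_mult_distrib \<mu>(2) using h q
          by (simp add: power2_eq_square field_simps)
        also have "\<dots> = (real h * (real n + x)\<^sup>2 / real q + - m * x) + - (m * real n)"
          by (simp add: algebra_simps)
        also have "ee \<dots> = ee (real h * (real n + x)\<^sup>2 / real q) * ee (- m * x)"
        proof -
          have "m * real n \<in> \<int>" using m by auto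
          thus ?thesis unfolding ee_add by (auto elim!: Ints_cases simp: ee_uminus)
        qed
        finally show ?thesis .
      qed
      have "((\<lambda>x. \<Sum>n<q. ee (real h * (real n + x)\<^sup>2 / real q) * ee (- m * x)) has_integral
              (\<Sum>n<q. K (real n + 1) - K (real n + 0))) {0..1}"
        by (intro has_integral_sum fundamental_theorem_of_calculus) (use K in auto)
      also have "(\<Sum>n<q. K (real n + 1) - K (real n + 0)) = (\<Sum>n<q. K (real (Suc n)) - K (real n))"
        by (simp add: add.commute)
      also have "\<dots> = K (real q) - K 0" by (subst sum_lessThan_telescope) simp
      also have "K (real q) - K 0 = of_real (1 / \<mu>) * W m"
        by (simp add: K_def W_def L_def algebra_simps)
      finally show ?thesis unfolding F_real sum_distrib_right by (rule integral_unique)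
    qed
    define E where "E = (\<lambda>r. ee (- (real r ^ 2 * real q / (4 * real h))))"
    define B where "B = (\<lambda>r J j. \<Phi> (L * (1 - (real j - real J) - real r / (2 * real h))))"
    \<comment> \<open>Replacing m = r by r + 2hk changes m^2 q/(4h) by the integer k r q + h k^2 q,
      so the phase depends only on r, while the interval of integration moves by exactly its length
      L. Hence the intervals of one residue class abut and their integrals telescope.\<close>
    have W: "W (real (r + j * (2 * h)) - real (2 * h * J)) = E r * (B r J j - B r J (Suc j))" for r j J
    proof -
      define k where "k = real j - real J"
      have m: "real (r + j * (2 * h)) - real (2 * h * J) = real r + 2 * real h * k"
        by (simp add: k_def algebra_simps)
      have "- ((real r + 2 * real h * k)\<^sup>2 * real q / (4 * real h)) =
            - (real r ^ 2 * real q / (4 * real h)) + of_int (- ((int j - int J) * int r * int q + int h * (int j - int J)\<^sup>2 * int q))"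
        using h by (simp add: k_def power2_eq_square field_simps)
      hence "ee (- ((real r + 2 * real h * k)\<^sup>2 * real q / (4 * real h))) = E r"
        unfolding E_def by (simp only: ee_add_of_int)
      moreover have "1 - (real r + 2 * real h * k) / (2 * real h) = 1 - k - real r / (2 * real h)"
           "- (real r + 2 * real h * k) / (2 * real h) = 1 - (k + 1) - real r / (2 * real h)"
        using h by (simp_all add: field_simps)
      ultimately show ?thesis unfolding W_def m B_def by (simp add: k_def algebra_simps)
    qed
    \<comment> \<open>The half-open window of frequencies from -2hJ to 2hJ - 1 consists of 2J whole
      periods of length 2h, so every residue class occurs equally often, with no leftover term at an
      end.\<close>
    have sum_eq: "(\<Sum>i<2*(2*h*J). integral {0..1} (\<lambda>x. F (of_real x) * ee (- (real i - real (2*h*J)) * x))) =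
       of_real (1 / \<mu>) * (\<Sum>r<2*h. E r * (B r J 0 - B r J (2*J)))" for J
    proof -
      have "(\<Sum>i<2*(2*h*J). integral {0..1} (\<lambda>x. F (of_real x) * ee (- (real i - real (2*h*J)) * x))) =
            (\<Sum>i<2*J*(2*h). of_real (1 / \<mu>) * W (real i - real (2*h*J)))"
        by (intro sum.cong coeff) auto
      also have "\<dots> = (\<Sum>j<2*J. \<Sum>r<2*h. of_real (1 / \<mu>) * W (real (r + j * (2*h)) - real (2*h*J)))"
      proof -
        have "sum f {j * (2*h)..<j * (2*h) + 2*h} = (\<Sum>r<2*h. f (r + j * (2*h)))" for f :: "nat \<Rightarrow> complex" and j
          using sum.shift_bounds_nat_ivl[of f 0 "j * (2*h)" "2*h"] by (simp add: atLeast0LessThan add.commute)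
        thus ?thesis by (subst sum.nat_group[symmetric]) simp
      qed
      also have "\<dots> = (\<Sum>r<2*h. of_real (1 / \<mu>) * (E r * (\<Sum>j<2*J. B r J j - B r J (Suc j))))"
        unfolding W by (subst sum.swap) (simp add: sum_distrib_left)
      also have "\<dots> = of_real (1 / \<mu>) * (\<Sum>r<2*h. E r * (B r J 0 - B r J (2*J)))"
        unfolding sum_lessThan_telescope' by (simp add: sum_distrib_left)
      finally show ?thesis .
    qed
    have "(\<lambda>J. of_real (1 / \<mu>) * (\<Sum>r<2*h. E r * (B r J 0 - B r J (2*J)))) \<longlonglongrightarrow>
          of_real (1 / \<mu>) * (\<Sum>r<2*h. E r * (l1 - (- l2')))"
    proof (intro tendsto_intros)
      fix r
      show "(\<lambda>J. B r J 0) \<longlonglongrightarrow> l1" unfolding B_def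
        by (rule filterlim_compose[OF l1]) (use L in real_asymp)
      show "(\<lambda>J. B r J (2*J)) \<longlonglongrightarrow> - l2'" unfolding B_def
        by (rule filterlim_compose[OF l2]) (use L in real_asymp)
    qed
    moreover have "(\<lambda>J. of_real (1 / \<mu>) * (\<Sum>r<2*h. E r * (B r J 0 - B r J (2*J)))) \<longlonglongrightarrow> F 0"
    proof -
      have "filterlim (\<lambda>J. 2 * h * J) at_top sequentially" using h by real_asymp
      from filterlim_compose[OF fourier_sum_at_0[OF F F01] this]
      show ?thesis unfolding sum_eq .
    qed
    ultimately have "F 0 = of_real (1 / \<mu>) * (\<Sum>r<2*h. E r * (l1 - (- l2')))"
      using LIMSEQ_unique by blast
    thus ?thesis unfolding F0 E_def inv_\<mu> sum_distrib_right[symmetric] by simp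
  qed
  thus ?thesis by blast
qed

section \<open>A weighted large sieve inequality\<close>

lemma norm_one_minus_ee: "norm (1 - ee x) = 2 * \<bar>sin (pi * x)\<bar>"
proof -
  have "norm (1 - ee x) = norm (exp (\<i> * of_real (2 * pi * x)) - 1)"
    by (simp add: ee_conv_exp norm_minus_commute mult_ac)
  thus ?thesis unfolding dist_exp_i_1 by simp
qed

lemma jordan_sin_le: 
  assumes "0 \<le> x" "x \<le> 1 / 2"
  shows "2 * x \<le> sin (pi * x)"
proof -
  have "convex_on {0..1} (\<lambda>x. - sin (pi * x))"
  proof (rule f''_ge0_imp_convex)
    show "((\<lambda>x. - sin (pi * x)) has_real_derivative - (pi * cos (pi * x))) (at x)" for x
      by (auto intro!: derivative_eq_intros)
    show "((\<lambda>x. - (pi * cos (pi * x))) has_real_derivative pi\<^sup>2 * sin (pi * x)) (at x)" for x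
      by (auto intro!: derivative_eq_intros simp: power2_eq_square)
    show "0 \<le> pi\<^sup>2 * sin (pi * x)" if "x \<in> {0..1}" for x
      using that by (intro mult_nonneg_nonneg sin_ge_zero) auto
  qed auto
  from convex_onD[OF this, of "2 * x" 0 "1 / 2"] show ?thesis using assms by simp
qed

text \<open>The form symmetric under x -> 1 - x replaces the distance to the nearest integer: a sum
  over separated points modulo 1 splits into two sums of reciprocals of separated points in (0,
  1].\<close>

lemma inverse_sin_pi_le:
  assumes "0 < x" "x < 1"
  shows "1 / sin (pi * x) \<le> (1 / x + 1 / (1 - x)) / 2"
proof -
  have aux: "1 / sin (pi * y) \<le> (1 / y + 1 / (1 - y)) / 2" if y: "0 < y" "y \<le> 1 / 2" for y
  proof -
    have s: "2 * y \<le> sin (pi * y)" using jordan_sin_le y by simp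
    hence "1 / sin (pi * y) \<le> 1 / (2 * y)" using y by (intro divide_left_mono mult_pos_pos) auto
    also have "\<dots> \<le> (1 / y + 1 / (1 - y)) / 2" using y by simp
    finally show ?thesis .
  qed
  show ?thesis
  proof (cases "x \<le> 1 / 2")
    case False
    have "sin (pi * (1 - x)) = sin (pi * x)" using sin_pi_minus[of "pi * x"] by (simp add: algebra_simps)
    thus ?thesis using aux[of "1 - x"] False assms by (simp add: add.commute)
  qed (use aux assms in auto)
qed

text \<open>Summation by parts, where monotone weights have total variation
  \<open>w A - w B\<close>. The induction carries the boundary term \<open>w B * z ^ B\<close>,
  since with it each step adds only the increment \<open>w n - w (Suc n)\<close>.\<close>

lemma norm_weighted_geometric_sum:
  fixes w :: "nat \<Rightarrow> real" and z :: complex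
  assumes "norm z = 1" "\<And>q. q \<ge> A \<Longrightarrow> w (Suc q) \<le> w q" "\<And>q. q \<ge> A \<Longrightarrow> w q \<ge> 0" "A \<le> B"
  shows "norm ((\<Sum>q=A..<B. of_real (w q) * z ^ q) * (1 - z)) \<le> 2 * w A"
proof -
  have "norm ((\<Sum>q=A..<B. of_real (w q) * z ^ q) * (1 - z) + of_real (w B) * z ^ B) \<le> 2 * w A - w B"
    using \<open>A \<le> B\<close>
  proof (induction B rule: dec_induct)
    case base
    show ?case using assms(1) assms(3)[of A] by (simp add: norm_mult norm_power)
  next
    case (step n)
    have "(\<Sum>q=A..<Suc n. of_real (w q) * z ^ q) * (1 - z) + of_real (w (Suc n)) * z ^ Suc n =
       ((\<Sum>q=A..<n. of_real (w q) * z ^ q) * (1 - z) + of_real (w n) * z ^ n) - of_real (w n - w (Suc n)) * z ^ Suc n"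
      using step by (simp add: algebra_simps)
    also have "norm \<dots> \<le> (2 * w A - w n) + (w n - w (Suc n))"
      using assms(2)[of n] step assms(1)
      by (intro order.trans[OF norm_triangle_ineq4] add_mono) (auto simp: norm_mult norm_power simp flip: of_real_diff)
    finally show ?case by simp
  qed
  moreover have "norm (of_real (w B) * z ^ B) = w B"
    using assms by (simp add: norm_mult norm_power)
  ultimately show ?thesis
    using norm_triangle_ineq4[of "(\<Sum>q=A..<B. of_real (w q) * z ^ q) * (1 - z) + of_real (w B) * z ^ B" "of_real (w B) * z ^ B"]
    by simp
qed

lemma norm_weighted_ee_sum:
  fixes w :: "nat \<Rightarrow> real"
  assumes "\<And>q. q \<ge> A \<Longrightarrow> w (Suc q) \<le> w q" "\<And>q. q \<ge> A \<Longrightarrow> w q \<ge> 0" "0 < x" "x < 1"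
  shows "norm (\<Sum>q=A..<B. of_real (w q) * ee (real q * x)) \<le> w A * ((1 / x + 1 / (1 - x)) / 2)"
proof (cases "A \<le> B")
  case True
  have s: "sin (pi * x) > 0" using assms by (intro sin_gt_zero) auto
  have "norm ((\<Sum>q=A..<B. of_real (w q) * ee (real q * x)) * (1 - ee x)) \<le> 2 * w A"
    unfolding ee_mult_of_nat using assms True by (intro norm_weighted_geometric_sum) auto
  hence "norm (\<Sum>q=A..<B. of_real (w q) * ee (real q * x)) * (2 * sin (pi * x)) \<le> 2 * w A"
    using s by (simp add: norm_mult norm_one_minus_ee)
  hence "norm (\<Sum>q=A..<B. of_real (w q) * ee (real q * x)) \<le> w A * (1 / sin (pi * x))"
    using s by (simp add: field_simps)
  also have "\<dots> \<le> w A * ((1 / x + 1 / (1 - x)) / 2)"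
    using assms by (intro mult_left_mono inverse_sin_pi_le) auto
  finally show ?thesis .
qed (use assms in auto)

text \<open>Points separated by 1/M have different values of floor(M x), all in {1..M}, so the sum
  is dominated term by term by M times a part of the harmonic sum.\<close>

lemma sum_inverse_spaced_le:
  fixes x :: "'a \<Rightarrow> real" and M :: nat
  assumes "finite I" "M > 0" "\<And>i. i \<in> I \<Longrightarrow> 1 / M \<le> x i \<and> x i \<le> 1"
    and "\<And>i j. i \<in> I \<Longrightarrow> j \<in> I \<Longrightarrow> i \<noteq> j \<Longrightarrow> \<bar>x i - x j\<bar> \<ge> 1 / M"
  shows "(\<Sum>i\<in>I. 1 / x i) \<le> M * harm M"
proof -
  define k where "k = (\<lambda>i. nat \<lfloor>M * x i\<rfloor>)"
  have k: "k i \<in> {1..M}" "k i \<le> M * x i" "M * x i < k i + 1" if "i \<in> I" for i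
  proof -
    have "M * x i \<ge> 1" "M * x i \<le> M" using assms(2,3) that by (auto simp: field_simps)
    thus "k i \<in> {1..M}" "k i \<le> M * x i" "M * x i < k i + 1" unfolding k_def by (auto simp: le_nat_iff nat_le_iff) linarith+
  qed
  have inj: "inj_on k I"
  proof (rule inj_onI, rule ccontr)
    fix i j assume ij: "i \<in> I" "j \<in> I" "k i = k j" "i \<noteq> j"
    have "\<bar>M * x i - M * x j\<bar> < 1" using k[OF ij(1)] k[OF ij(2)] ij(3) by linarith
    also have "\<bar>M * x i - M * x j\<bar> = M * \<bar>x i - x j\<bar>" by (simp add: abs_mult flip: right_diff_distrib)
    finally show False using assms(4)[OF ij(1,2,4)] assms(2) by (simp add: field_simps)
  qed
  have "(\<Sum>i\<in>I. 1 / x i) \<le> (\<Sum>i\<in>I. M * inverse (real (k i)))"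
  proof (rule sum_mono)
    fix i assume i: "i \<in> I"
    have "real (k i) > 0" using k(1)[OF i] by auto
    moreover have "x i > 0" using assms(2) assms(3)[OF i] by (auto intro: less_le_trans[rotated])
    ultimately show "1 / x i \<le> M * inverse (real (k i))"
      using k(2)[OF i] by (simp add: field_simps)
  qed
  also have "\<dots> = M * (\<Sum>j\<in>k ` I. inverse (real j))"
    using inj by (simp add: sum_distrib_left sum.reindex)
  also have "\<dots> \<le> M * (\<Sum>j\<in>{1..M}. inverse (real j))"
    using k(1) by (intro mult_left_mono sum_mono2) auto
  finally show ?thesis by (simp add: harm_def)
qed

text \<open>Opening the square and summing over q first leaves \<open>K (x - y)\<close>: the
  diagonal gives the total weight, and off the diagonal the decreasing weights give
  \<open>w A\<close> times reciprocal distances modulo 1. The condition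
  \<open>y - x \<le> 1 - 1 / M\<close> is the separation across the endpoint of the unit interval.
  The factor \<open>harm M\<close> is a logarithmic loss, harmless because the dyadic blocks will
  have a power to spare.\<close>

lemma weighted_large_sieve:
  fixes w :: "nat \<Rightarrow> real" and c :: "real \<Rightarrow> real" and M :: nat
  assumes R: "finite R" "R \<subseteq> {0..<1}" and M: "M > 0"
    and spaced: "\<And>x y. x \<in> R \<Longrightarrow> y \<in> R \<Longrightarrow> x < y \<Longrightarrow> 1 / M \<le> y - x \<and> y - x \<le> 1 - 1 / M"
    and w: "\<And>q. q \<ge> A \<Longrightarrow> w (Suc q) \<le> w q" "\<And>q. q \<ge> A \<Longrightarrow> w q \<ge> 0"
  shows "(\<Sum>q=A..<B. w q * norm (\<Sum>x\<in>R. of_real (c x) * ee (real q * x)) ^ 2) \<le>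
     ((\<Sum>q=A..<B. w q) + w A * (M * harm M)) * (\<Sum>x\<in>R. c x ^ 2)"
proof -
  define K where "K = (\<lambda>x. \<Sum>q=A..<B. of_real (w q) * ee (real q * x))"
  define D where "D = (\<Sum>q=A..<B. w q) + w A * (M * harm M)"
  have K_uminus: "norm (K (- x)) = norm (K x)" for x
  proof -
    have "K (- x) = cnj (K x)" by (simp add: K_def ee_uminus)
    thus ?thesis by simp
  qed
  have K_frac: "K (frac x) = K x" for x
  proof -
    have "ee (real q * frac x) = ee (real q * x)" for q
    proof -
      have "real q * frac x = real q * x + of_int (- (int q * \<lfloor>x\<rfloor>))" by (simp add: frac_def algebra_simps)
      thus ?thesis by (simp only: ee_add_of_int)
    qed
    thus ?thesis by (simp add: K_def)
  qed
  have row: "(\<Sum>y\<in>R. norm (K (x - y))) \<le> D" if x: "x \<in> R" for x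
  proof -
    have fr: "1 / M \<le> frac (x - y) \<and> frac (x - y) \<le> 1 - 1 / M" if "y \<in> R - {x}" for y
    proof (cases "y < x")
      case True
      moreover have "1 / M > 0" using M by simp
      moreover have "1 / M \<le> x - y" "x - y \<le> 1 - 1 / M" using spaced[of y x] that x True by auto
      ultimately have "frac (x - y) = x - y" unfolding frac_eq by linarith
      thus ?thesis using spaced[of y x] that x True by simp
    next
      case False
      hence lt: "x < y" using that by auto
      moreover have "1 / M > 0" using M by simp
      moreover have "1 / M \<le> y - x" "y - x \<le> 1 - 1 / M" using spaced[of x y] that x lt by auto
      moreover have "x - y - (x - y + 1) \<in> \<int>" by simp
      ultimately have "frac (x - y) = x - y + 1" unfolding frac_unique_iff by linarith
      thus ?thesis using spaced[of x y] that x lt by simp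
    qed
    have fr_spaced: "\<bar>frac (x - y) - frac (x - z)\<bar> \<ge> 1 / M" if "y \<in> R" "z \<in> R" "y \<noteq> z" for y z
    proof -
      have yz: "1 / M \<le> \<bar>y - z\<bar> \<and> \<bar>y - z\<bar> \<le> 1 - 1 / M"
        using spaced[of y z] spaced[of z y] that by (cases "y < z") auto
      define n where "n = \<lfloor>x - z\<rfloor> - \<lfloor>x - y\<rfloor>"
      have eq: "frac (x - y) - frac (x - z) = (z - y) + of_int n" by (simp add: frac_def n_def)
      consider "n = 0" | "n \<ge> 1" | "n \<le> -1" by linarith
      thus ?thesis
      proof cases
        case 2
        hence "of_int n \<ge> (1::real)" by simp
        thus ?thesis unfolding eq using yz by linarith
      next
        case 3
        hence "of_int n \<le> (-1::real)" by linarith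
        thus ?thesis unfolding eq using yz by linarith
      qed (use yz eq in auto)
    qed
    have h1: "(\<Sum>y\<in>R-{x}. 1 / frac (x - y)) \<le> M * harm M"
      using fr fr_spaced R(1) M by (intro sum_inverse_spaced_le) (auto simp: frac_lt_1 less_imp_le)
    have h2: "(\<Sum>y\<in>R-{x}. 1 / (1 - frac (x - y))) \<le> M * harm M"
    proof (intro sum_inverse_spaced_le)
      fix i j assume "i \<in> R - {x}" "j \<in> R - {x}" "i \<noteq> j"
      thus "1 / real M \<le> \<bar>(1 - frac (x - i)) - (1 - frac (x - j))\<bar>"
        using fr_spaced[of j i] by simp
    next
      fix i assume "i \<in> R - {x}"
      thus "1 / real M \<le> 1 - frac (x - i) \<and> 1 - frac (x - i) \<le> 1" using fr[of i] by auto
    qed (use R(1) M in auto)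
    have "(\<Sum>y\<in>R-{x}. norm (K (x - y))) \<le> (\<Sum>y\<in>R-{x}. w A * ((1 / frac (x - y) + 1 / (1 - frac (x - y))) / 2))"
    proof (rule sum_mono)
      fix y assume y: "y \<in> R - {x}"
      have "1 / real M > 0" using M by simp
      hence "0 < frac (x - y)" "frac (x - y) < 1" using fr[OF y] by linarith+
      hence "norm (K (frac (x - y))) \<le> w A * ((1 / frac (x - y) + 1 / (1 - frac (x - y))) / 2)"
        using w unfolding K_def by (intro norm_weighted_ee_sum) blast+
      thus "norm (K (x - y)) \<le> w A * ((1 / frac (x - y) + 1 / (1 - frac (x - y))) / 2)"
        by (simp add: K_frac)
    qed
    also have "\<dots> = w A * (((\<Sum>y\<in>R-{x}. 1 / frac (x - y)) + (\<Sum>y\<in>R-{x}. 1 / (1 - frac (x - y)))) / 2)"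
      unfolding sum.distrib[symmetric] sum_divide_distrib sum_distrib_left ..
    also have "\<dots> \<le> w A * ((M * harm M + M * harm M) / 2)"
      using h1 h2 w(2)[of A] by (intro mult_left_mono divide_right_mono add_mono) auto
    finally have "(\<Sum>y\<in>R-{x}. norm (K (x - y))) \<le> w A * (M * harm M)" by (simp add: mult_ac)
    moreover have "norm (K 0) = (\<Sum>q=A..<B. w q)"
    proof -
      have "K 0 = of_real (\<Sum>q=A..<B. w q)" by (simp add: K_def)
      moreover have "(\<Sum>q=A..<B. w q) \<ge> 0" using w(2) by (intro sum_nonneg) auto
      ultimately show ?thesis by (simp del: of_real_sum)
    qed
    ultimately show ?thesis using x R(1) by (subst sum.remove[of _ x]) (auto simp: D_def)
  qed
  have sq: "of_real (norm (\<Sum>x\<in>R. of_real (c x) * ee (real q * x)) ^ 2) =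
     (\<Sum>x\<in>R. \<Sum>y\<in>R. of_real (c x * c y) * ee (real q * (x - y)))" for q
  proof -
    have "of_real (norm (\<Sum>x\<in>R. of_real (c x) * ee (real q * x)) ^ 2) =
      (\<Sum>x\<in>R. of_real (c x) * ee (real q * x)) * (\<Sum>y\<in>R. of_real (c y) * ee (- (real q * y)))"
      unfolding complex_norm_square by (simp add: ee_uminus)
    also have "\<dots> = (\<Sum>x\<in>R. \<Sum>y\<in>R. of_real (c x * c y) * ee (real q * x + - (real q * y)))"
      unfolding sum_product ee_add by (simp add: mult_ac)
    finally show ?thesis by (simp add: algebra_simps)
  qed
  have "complex_of_real (\<Sum>q=A..<B. w q * norm (\<Sum>x\<in>R. of_real (c x) * ee (real q * x)) ^ 2) =
     (\<Sum>q=A..<B. \<Sum>x\<in>R. \<Sum>y\<in>R. of_real (c x * c y) * (of_real (w q) * ee (real q * (x - y))))"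
    unfolding of_real_sum of_real_mult sq by (simp add: sum_distrib_left mult_ac)
  also have "\<dots> = (\<Sum>x\<in>R. \<Sum>y\<in>R. of_real (c x * c y) * K (x - y))"
    unfolding K_def sum_distrib_left by (subst sum.swap, rule sum.cong[OF refl], subst sum.swap, rule refl)
  finally have "norm (complex_of_real (\<Sum>q=A..<B. w q * norm (\<Sum>x\<in>R. of_real (c x) * ee (real q * x)) ^ 2)) =
     norm (\<Sum>x\<in>R. \<Sum>y\<in>R. of_real (c x * c y) * K (x - y))" by (rule arg_cong)
  hence "(\<Sum>q=A..<B. w q * norm (\<Sum>x\<in>R. of_real (c x) * ee (real q * x)) ^ 2) \<le>
     norm (\<Sum>x\<in>R. \<Sum>y\<in>R. of_real (c x * c y) * K (x - y))"
    unfolding norm_of_real by linarith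
  \<comment> \<open>Schur test: after 2|a b| <= a^2 + b^2 the two halves coincide because |K| is
    even, and only row sums of |K| remain.\<close>
  also have "\<dots> \<le> (\<Sum>x\<in>R. \<Sum>y\<in>R. (c x ^ 2 / 2 + c y ^ 2 / 2) * norm (K (x - y)))"
  proof (intro order.trans[OF norm_sum] sum_mono)
    fix x y
    have "\<bar>c x\<bar> * \<bar>c y\<bar> \<le> c x ^ 2 / 2 + c y ^ 2 / 2"
      using sum_squares_bound[of "\<bar>c x\<bar>" "\<bar>c y\<bar>"] by simp
    thus "norm (of_real (c x * c y) * K (x - y)) \<le> (c x ^ 2 / 2 + c y ^ 2 / 2) * norm (K (x - y))"
      unfolding norm_mult norm_of_real abs_mult by (rule mult_right_mono) simp
  qed
  also have "\<dots> = (\<Sum>x\<in>R. \<Sum>y\<in>R. c x ^ 2 / 2 * norm (K (x - y))) + (\<Sum>y\<in>R. \<Sum>x\<in>R. c y ^ 2 / 2 * norm (K (x - y)))"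
    unfolding distrib_right sum.distrib by (subst (3) sum.swap) (rule refl)
  also have "(\<Sum>y\<in>R. \<Sum>x\<in>R. c y ^ 2 / 2 * norm (K (x - y))) = (\<Sum>x\<in>R. \<Sum>y\<in>R. c x ^ 2 / 2 * norm (K (x - y)))"
    using K_uminus[of "x - y" for x y] by simp
  also have "(\<Sum>x\<in>R. \<Sum>y\<in>R. c x ^ 2 / 2 * norm (K (x - y))) + (\<Sum>x\<in>R. \<Sum>y\<in>R. c x ^ 2 / 2 * norm (K (x - y))) =
     (\<Sum>x\<in>R. c x ^ 2 * (\<Sum>y\<in>R. norm (K (x - y))))"
    by (simp add: sum_distrib_left mult.commute flip: sum.distrib)
  also have "\<dots> \<le> (\<Sum>x\<in>R. c x ^ 2 * D)" by (intro sum_mono mult_left_mono row) auto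
  finally show ?thesis by (simp add: D_def sum_distrib_right mult.commute)
qed

section \<open>Square roots modulo an integer\<close>

lemma squarefree_dvd_square_imp_dvd:
  fixes e m :: nat
  assumes "squarefree e" "e dvd m\<^sup>2"
  shows "e dvd m"
proof (cases "m = 0")
  case False
  define d where "d = gcd e m"
  have "e \<noteq> 0" using assms(1) by (metis not_squarefree_0)
  hence "d \<noteq> 0" by (simp add: d_def)
  then obtain e' m' where *: "e = e' * d" "m = m' * d" "coprime e' m'"
    unfolding d_def using gcd_coprime_exists by blast
  have d: "d > 0" using \<open>d \<noteq> 0\<close> by simp
  have "e' dvd m'\<^sup>2 * d" using assms(2) d by (simp add: * power2_eq_square mult_ac)
  moreover have "coprime e' (m'\<^sup>2)" using *(3) by simp
  ultimately have "e' dvd d" by (simp add: coprime_dvd_mult_right_iff)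
  hence "e'\<^sup>2 dvd e" by (simp add: * power2_eq_square mult_dvd_mono)
  hence "e' = 1" using squarefreeD[OF assms(1)] by auto
  thus ?thesis using * by simp
qed auto

lemma card_mod_eq_count:
  fixes v f :: nat
  shows "card {x. x < v * f \<and> P (x mod v)} = f * card {x. x < v \<and> P x}"
proof (induction f)
  case (Suc f)
  have "{x. x < v * Suc f \<and> P (x mod v)} = {x. x < v * f \<and> P (x mod v)} \<union> (\<lambda>x. x + v * f) ` {x. x < v \<and> P x}"
  proof safe
    fix x assume x: "x < v * Suc f" "P (x mod v)" "x \<notin> (\<lambda>x. x + v * f) ` {x. x < v \<and> P x}"
    show "x < v * f"
    proof (rule ccontr)
      assume "\<not> x < v * f"
      then obtain y where y: "x = y + v * f" by (auto dest!: le_Suc_ex simp: not_less add.commute)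
      with x show False by auto
    qed
  qed auto
  moreover have "{x. x < v * f \<and> P (x mod v)} \<inter> (\<lambda>x. x + v * f) ` {x. x < v \<and> P x} = {}" by auto
  moreover have "card ((\<lambda>x. x + v * f) ` {x. x < v \<and> P x}) = card {x. x < v \<and> P x}"
    by (intro card_image) (auto simp: inj_on_def)
  ultimately show ?case using Suc by (simp add: card_Un_disjoint)
qed auto

definition square_pairs :: "nat \<Rightarrow> (nat \<times> nat) set" where
  "square_pairs v = {(x, y). x < v \<and> y < v \<and> int v dvd (int x)\<^sup>2 - (int y)\<^sup>2}"

lemma finite_square_pairs [simp]: "finite (square_pairs v)"
  by (rule finite_subset[of _ "{..<v} \<times> {..<v}"]) (auto simp: square_pairs_def)

text \<open>If v divides (x - y)(x + y) and d = gcd(x - y, v), then v/d divides x + y. For fixed d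
  with v = d v', the pair is determined by (x - y)/d, of absolute value below v', and (x + y)/v', in
  [0, 2d): at most 2v' * 2d = 4v possibilities.\<close>

lemma card_square_pairs_le:
  assumes "v > 0"
  shows "card (square_pairs v) \<le> 4 * v * card {d. d dvd v}"
proof -
  define A where "A = (\<lambda>d. {(x, y). x < v \<and> y < v \<and> int d dvd int x - int y \<and> int (v div d) dvd int x + int y})"
  have fin: "finite {d. d dvd v}" using assms by simp
  have "square_pairs v \<subseteq> (\<Union>d\<in>{d. d dvd v}. A d)"
  proof safe
    fix x y assume xy: "(x, y) \<in> square_pairs v"
    define d where "d = gcd (int x - int y) (int v)"
    have "d > 0" using assms by (simp add: d_def)
    obtain a v' where av: "int x - int y = a * d" "int v = v' * d" "coprime a v'"
      using \<open>d > 0\<close> gcd_coprime_exists[of "int x - int y" "int v"] unfolding d_def by auto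
    have "v' * d dvd (a * d) * (int x + int y)"
      using xy unfolding av(1,2)[symmetric] square_pairs_def by (simp add: power2_eq_square algebra_simps)
    hence "v' dvd a * (int x + int y)" using \<open>d > 0\<close> by (simp add: mult_ac)
    hence "v' dvd int x + int y" using av(3) by (simp add: coprime_commute coprime_dvd_mult_right_iff)
    moreover have "v' = int (v div nat d)"
      using av(2) \<open>d > 0\<close> by (simp add: zdiv_int)
    moreover have "int (nat d) dvd int v" using av(2) \<open>d > 0\<close> by simp
    hence "nat d dvd v" by (simp only: int_dvd_int_iff)
    moreover have "int (nat d) dvd int x - int y" using av(1) \<open>d > 0\<close> by simp
    ultimately show "(x, y) \<in> (\<Union>d\<in>{d. d dvd v}. A d)"
      using xy by (auto simp: A_def square_pairs_def)
  qed
  moreover have finA: "finite (A d)" for d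
    by (rule finite_subset[of _ "{..<v} \<times> {..<v}"]) (auto simp: A_def)
  ultimately have "card (square_pairs v) \<le> card (\<Union>d\<in>{d. d dvd v}. A d)"
    using fin by (intro card_mono) auto
  also have "\<dots> \<le> (\<Sum>d\<in>{d. d dvd v}. card (A d))" using fin by (rule card_UN_le)
  also have "\<dots> \<le> (\<Sum>d\<in>{d. d dvd v}. 4 * v)"
  proof (rule sum_mono)
    fix d assume "d \<in> {d. d dvd v}"
    then obtain v' where v: "v = d * v'" by auto
    have dv: "d > 0" "v' > 0" using assms v by auto
    define \<phi> where "\<phi> = (\<lambda>(x, y). ((int x - int y) div int d, (int x + int y) div int v'))"
    have v': "v div d = v'" using v dv by simp
    have "inj_on \<phi> (A d)"
    proof (rule inj_onI, clarify)
      fix x y x' y' assume *: "(x, y) \<in> A d" "(x', y') \<in> A d" "\<phi> (x, y) = \<phi> (x', y')"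
      from * have "int x - int y = int x' - int y'" "int x + int y = int x' + int y'"
        by (auto simp: A_def \<phi>_def v' dvd_div_eq_iff)
      thus "x = x' \<and> y = y'" by linarith
    qed
    moreover have "\<phi> ` A d \<subseteq> {- int v'<..<int v'} \<times> {0..<2 * int d}"
    proof safe
      fix x y a b assume *: "(x, y) \<in> A d" "(a, b) = \<phi> (x, y)"
      have a: "int x - int y = int d * a" and b: "int x + int y = int v' * b"
        using * by (auto simp: A_def \<phi>_def v')
      have "int d * a < int d * int v'" "int d * a > int d * (- int v')"
        using * unfolding a[symmetric] by (auto simp: A_def v simp flip: of_nat_mult)
      thus "a \<in> {- int v'<..<int v'}" using dv by (auto simp only: mult_less_cancel_left_pos of_nat_0_less_iff greaterThanLessThan_iff)
      have "int x < int d * int v'" "int y < int d * int v'"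
        using * by (auto simp: A_def v simp flip: of_nat_mult)
      hence "int x + int y < 2 * (int d * int v')" by linarith
      hence "int x + int y < int v' * (2 * int d)" by (simp add: mult_ac)
      hence "int v' * b \<ge> int v' * 0" "int v' * b < int v' * (2 * int d)"
        unfolding b[symmetric] by auto
      thus "b \<in> {0..<2 * int d}" using dv by (auto simp only: mult_less_cancel_left_pos mult_le_cancel_left_pos of_nat_0_less_iff atLeastLessThan_iff)
    qed
    ultimately have "card (A d) \<le> card ({- int v'<..<int v'} \<times> {0..<2 * int d})"
      by (intro card_inj_on_le[of \<phi>]) auto
    also have "\<dots> = nat (2 * int v' - 1) * (2 * d)" by (simp add: card_cartesian_product nat_mult_distrib)
    also have "\<dots> \<le> (2 * v') * (2 * d)" by (intro mult_right_mono) auto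
    finally show "card (A d) \<le> 4 * v" by (simp add: v mult_ac)
  qed
  finally show ?thesis by (simp add: mult.commute)
qed

definition root_count :: "nat \<Rightarrow> nat \<Rightarrow> nat \<Rightarrow> nat" where
  "root_count v e u = card {x. x < v \<and> e * x\<^sup>2 mod v = u}"

text \<open>The second moment counts pairs x, y with e x^2 and e y^2 congruent to the same u.
  Coprimality of u to v forces e to be a unit modulo v, so e cancels and the bound is uniform in
  e.\<close>

lemma sum_root_count_square_le:
  "(\<Sum>u | u < v \<and> coprime u v. (root_count v e u)\<^sup>2) \<le> card (square_pairs v)"
proof -
  define X where "X = (\<lambda>u. {x. x < v \<and> e * x\<^sup>2 mod v = u})"
  have fin: "finite (X u)" for u by (simp add: X_def)
  have "(\<Sum>u | u < v \<and> coprime u v. (root_count v e u)\<^sup>2) = (\<Sum>u | u < v \<and> coprime u v. card (X u \<times> X u))"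
    by (simp add: root_count_def X_def card_cartesian_product power2_eq_square)
  also have "\<dots> = card (SIGMA u:{u. u < v \<and> coprime u v}. X u \<times> X u)"
    using fin by (subst card_SigmaI) auto
  also have "\<dots> \<le> card (square_pairs v)"
  proof (rule card_inj_on_le[of snd])
    show "inj_on snd (SIGMA u:{u. u < v \<and> coprime u v}. X u \<times> X u)"
      by (auto simp: inj_on_def X_def)
    show "snd ` (SIGMA u:{u. u < v \<and> coprime u v}. X u \<times> X u) \<subseteq> square_pairs v"
    proof clarsimp
      fix u x y assume *: "u < v" "coprime u v" "x \<in> X u" "y \<in> X u"
      have "coprime (e * x\<^sup>2) v" using *(2,3) by (auto simp: X_def simp flip: coprime_mod_left_iff[of v "e * x\<^sup>2"])
      hence "coprime e v" by simp
      have "int (e * x\<^sup>2) mod int v = int (e * y\<^sup>2) mod int v"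
        using *(3,4) by (simp only: X_def mem_Collect_eq flip: of_nat_mod)
      hence "int v dvd int e * ((int x)\<^sup>2 - (int y)\<^sup>2)"
        by (simp add: mod_eq_dvd_iff algebra_simps)
      moreover have "coprime (int v) (int e)" using \<open>coprime e v\<close> by (simp add: coprime_commute)
      ultimately have "int v dvd (int x)\<^sup>2 - (int y)\<^sup>2"
        by (simp add: coprime_dvd_mult_right_iff)
      thus "(x, y) \<in> square_pairs v" using * by (auto simp: square_pairs_def X_def)
    qed
  qed auto
  finally show ?thesis .
qed

text \<open>
  With \<open>4 * h = v * g\<close>, \<open>g = e * f\<^sup>2\<close> and \<open>e\<close> squarefree, \<open>g\<close> divides \<open>n\<^sup>2\<close> and hence \<open>e * f\<close> divides \<open>n\<close>.
\<close>

lemma frac_square_eq_imp_param: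
  fixes u v h n :: nat
  assumes "v > 0" "h > 0" "coprime u v" "u < v" "n < 2 * h"
    and frac: "frac (real n ^ 2 / (4 * real h)) = real u / real v"
  shows "\<exists>e f x. e > 0 \<and> f > 0 \<and> 4 * h = v * e * f\<^sup>2 \<and> n = e * f * x \<and> x < v * f \<and> e * x\<^sup>2 mod v = u"
proof -
  define k where "k = nat \<lfloor>real n ^ 2 / (4 * real h)\<rfloor>"
  have "real n ^ 2 / (4 * real h) = real k + real u / real v"
    using frac unfolding frac_def k_def by (simp add: algebra_simps)
  hence "real n ^ 2 * real v = 4 * real h * (real k * real v + real u)"
    using assms by (simp add: field_simps)
  hence "real (n\<^sup>2 * v) = real (4 * h * (k * v + u))" by simp
  hence eq: "n\<^sup>2 * v = 4 * h * (k * v + u)" by (simp only: of_nat_eq_iff)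
  have "gcd v (k * v + u) = gcd v u" by (simp add: gcd_add_mult)
  hence "coprime v (k * v + u)" using assms(3) by (simp add: coprime_iff_gcd_eq_1 gcd.commute)
  moreover have "v dvd 4 * h * (k * v + u)" unfolding eq[symmetric] by simp
  ultimately have "v dvd 4 * h" by (simp add: coprime_dvd_mult_left_iff)
  then obtain g where g: "4 * h = v * g" by auto
  have "g > 0" using g assms(2) by (cases g) auto
  have n2: "n\<^sup>2 = g * (k * v + u)" using eq assms(1) unfolding g by simp
  define e f where "e = squarefree_part g" and "f = square_part g"
  have gef: "g = e * f\<^sup>2" unfolding e_def f_def by (rule squarefree_decompose)
  have ef: "e > 0" "f > 0" using gef \<open>g > 0\<close> by (auto intro: Nat.gr0I)
  have "f\<^sup>2 dvd n\<^sup>2" unfolding n2 gef by simp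
  hence "f dvd n" by simp
  then obtain m where m: "n = f * m" by auto
  have "m\<^sup>2 = e * (k * v + u)" using n2 ef unfolding m gef by (simp add: power_mult_distrib mult_ac)
  hence "e dvd m\<^sup>2" by simp
  moreover have "squarefree e" unfolding e_def by (rule squarefree_squarefree_part)
  ultimately have "e dvd m" by (rule squarefree_dvd_square_imp_dvd[rotated])
  then obtain x where x: "m = e * x" by auto
  have ex: "e * x\<^sup>2 = k * v + u"
    using \<open>m\<^sup>2 = e * (k * v + u)\<close> ef unfolding x by (simp add: power2_eq_square mult_ac)
  \<comment> \<open>The resulting range \<open>x < v * f\<close> is f whole periods modulo v, so for
    given e and f the number of admissible x is f times a count of roots modulo v.\<close>
  have "n = e * f * x" "4 * h = e * f * (v * f)"
    using g unfolding m x gef by (simp_all add: power2_eq_square)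
  hence "(e * f) * x < (e * f) * (v * f)" using assms(5) by linarith
  hence "x < v * f" using ef by (simp only: mult_less_cancel1)
  moreover have "e * x\<^sup>2 mod v = u" using assms(4) unfolding ex by simp
  ultimately show ?thesis using g gef ef by (intro exI[of _ e] exI[of _ f] exI[of _ x]) (auto simp: m x mult_ac)
qed

section \<open>Auxiliary inequalities for weighted sums and divisor sums\<close>

lemma weighted_Cauchy_Schwarz:
  fixes a b :: "'a \<Rightarrow> real"
  assumes "\<And>i. i \<in> I \<Longrightarrow> a i \<ge> 0"
  shows "(\<Sum>i\<in>I. a i * b i)\<^sup>2 \<le> (\<Sum>i\<in>I. a i) * (\<Sum>i\<in>I. a i * (b i)\<^sup>2)"
proof -
  have "(\<Sum>i\<in>I. a i * b i) = (\<Sum>i\<in>I. sqrt (a i) * (sqrt (a i) * b i))"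
    using assms by (intro sum.cong) (auto simp flip: mult.assoc)
  moreover have "(\<Sum>i\<in>I. (sqrt (a i))\<^sup>2) = (\<Sum>i\<in>I. a i)"
    using assms by (intro sum.cong) auto
  moreover have "(\<Sum>i\<in>I. (sqrt (a i) * b i)\<^sup>2) = (\<Sum>i\<in>I. a i * (b i)\<^sup>2)"
    using assms by (intro sum.cong) (auto simp: power_mult_distrib)
  ultimately show ?thesis using Cauchy_Schwarz_ineq_sum[of "\<lambda>i. sqrt (a i)" "\<lambda>i. sqrt (a i) * b i" I] by simp
qed

lemma sum_inverse_sqrt_le: "(\<Sum>e\<in>{1..n}. 1 / sqrt (real e)) \<le> 2 * sqrt (real n)"
proof (induction n)
  case (Suc n)
  define a b where "a = sqrt (real n)" and "b = sqrt (real (Suc n))"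
  have ab: "0 \<le> a" "0 < b" "a\<^sup>2 = real n" "b\<^sup>2 = real n + 1" by (auto simp: a_def b_def)
  have "(b - a)\<^sup>2 \<ge> 0" by simp
  hence "2 * a * b + 1 \<le> 2 * (b * b)" using ab by (simp add: power2_eq_square algebra_simps)
  hence "2 * a + 1 / b \<le> 2 * b" using ab by (simp add: field_simps)
  thus ?case using Suc by (simp add: a_def b_def)
qed auto

text \<open>Writing v = d b turns the sum into a part of the double sum of 1/(d b) over d, b <=
  N.\<close>

lemma sum_divisor_count_div_le:
  "(\<Sum>v\<in>{1..N}. real (card {d. d dvd v}) / real v) \<le> (harm N)\<^sup>2"
proof -
  have "(\<Sum>v\<in>{1..N}. real (card {d. d dvd v}) / real v) = (\<Sum>v\<in>{1..N}. \<Sum>d\<in>{d. d dvd v}. 1 / real v)"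
    by simp
  also have "\<dots> = (\<Sum>(v, d)\<in>(SIGMA v:{1..N}. {d. d dvd v}). 1 / real v)"
    by (subst sum.Sigma) auto
  also have "\<dots> \<le> (\<Sum>(a, b)\<in>{1..N} \<times> {1..N}. inverse (real a) * inverse (real b))"
  proof (rule sum_le_included[where i = "\<lambda>(a, b). (a * b, a)"])
    show "\<forall>x\<in>SIGMA v:{1..N}. {d. d dvd v}. \<exists>y\<in>{1..N} \<times> {1..N}. (case y of (a, b) \<Rightarrow> (a * b, a)) = x \<and>
       (case x of (v, d) \<Rightarrow> 1 / real v) \<le> (case y of (a, b) \<Rightarrow> inverse (real a) * inverse (real b))"
    proof safe
      fix v d assume v: "v \<in> {1..N}" "d dvd v"
      then obtain b where b: "v = d * b" by auto
      hence "d \<in> {1..N}" "b \<in> {1..N}" using v by (auto intro: order.trans[rotated] simp: Suc_le_eq)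
      thus "\<exists>y\<in>{1..N} \<times> {1..N}. (case y of (a, b) \<Rightarrow> (a * b, a)) = (v, d) \<and>
       1 / real v \<le> (case y of (a, b) \<Rightarrow> inverse (real a) * inverse (real b))"
        by (intro bexI[of _ "(d, b)"]) (auto simp: b inverse_eq_divide)
    qed
  qed auto
  also have "\<dots> = (harm N)\<^sup>2"
    by (simp add: harm_def power2_eq_square sum_product sum.cartesian_product)
  finally show ?thesis .
qed

section \<open>Mean squares of the dual sums\<close>

text \<open>With N = 4H these contain all pairs from the factorizations 4h = v e f^2 with h < H. The
  number e ranges over all positive integers, squarefree or not, since only upper bounds are summed
  over this set.\<close>

definition square_factorizations :: "nat \<Rightarrow> nat \<Rightarrow> (nat \<times> nat) set" where
  "square_factorizations v N = {(e, f). e > 0 \<and> f > 0 \<and> v * e * f\<^sup>2 \<le> N}"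

lemma square_factorizations_subset:
  assumes "v > 0"
  shows "square_factorizations v N \<subseteq> (\<lambda>(f, e). (e, f)) ` (SIGMA f:{1..N}. {1..N div (v * f\<^sup>2)})"
proof clarify
  fix e f assume *: "(e, f) \<in> square_factorizations v N"
  hence "f \<le> v * e * f\<^sup>2" using assms by (simp add: square_factorizations_def power2_eq_square)
  moreover have "e \<le> N div (v * f\<^sup>2)"
    using * assms by (simp add: square_factorizations_def less_eq_div_iff_mult_less_eq mult_ac)
  ultimately show "(e, f) \<in> (\<lambda>(f, e). (e, f)) ` (SIGMA f:{1..N}. {1..N div (v * f\<^sup>2)})"
    using * by (intro image_eqI[of _ _ "(f, e)"]) (auto simp: square_factorizations_def)
qed

lemma finite_square_factorizations:
  "v > 0 \<Longrightarrow> finite (square_factorizations v N)"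
  using square_factorizations_subset by (rule finite_subset) auto

text \<open>For fixed f, e runs up to N/(v f^2), and the sum of 1/sqrt e is of the order of the
  square root of that bound, which leaves a factor 1/f and hence only a harmonic sum over f.\<close>

lemma sum_square_factorizations_le:
  assumes "v > 0"
  shows "(\<Sum>(e, f)\<in>square_factorizations v N. 1 / sqrt (real e)) \<le> 2 * sqrt (real N / real v) * harm N"
proof -
  have "(\<Sum>(e, f)\<in>square_factorizations v N. 1 / sqrt (real e)) \<le>
      (\<Sum>(e, f)\<in>(\<lambda>(f, e). (e, f)) ` (SIGMA f:{1..N}. {1..N div (v * f\<^sup>2)}). 1 / sqrt (real e))"
    using square_factorizations_subset[OF assms, of N] by (intro sum_mono2) auto
  also have "\<dots> = (\<Sum>(f, e)\<in>(SIGMA f:{1..N}. {1..N div (v * f\<^sup>2)}). 1 / sqrt (real e))"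
    by (subst sum.reindex) (auto simp: inj_on_def case_prod_unfold)
  also have "\<dots> = (\<Sum>f\<in>{1..N}. \<Sum>e\<in>{1..N div (v * f\<^sup>2)}. 1 / sqrt (real e))"
    by (subst sum.Sigma) auto
  also have "\<dots> \<le> (\<Sum>f\<in>{1..N}. 2 * sqrt (real N / real v) * inverse (real f))"
  proof (rule sum_mono)
    fix f assume f: "f \<in> {1..N}"
    have "(\<Sum>e\<in>{1..N div (v * f\<^sup>2)}. 1 / sqrt (real e)) \<le> 2 * sqrt (real (N div (v * f\<^sup>2)))"
      by (rule sum_inverse_sqrt_le)
    also have "real (N div (v * f\<^sup>2)) \<le> real N / real v / (real f)\<^sup>2"
    proof -
      have "real ((N div (v * f\<^sup>2)) * (v * f\<^sup>2)) \<le> real N"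
        unfolding of_nat_le_iff by (rule div_times_less_eq_dividend)
      moreover have "v > 0" "f > 0" using assms f by auto
      ultimately show ?thesis by (simp add: field_simps)
    qed
    also have "sqrt (real N / real v / (real f)\<^sup>2) = sqrt (real N / real v) * inverse (real f)"
      unfolding real_sqrt_divide by (simp add: divide_inverse)
    finally show "(\<Sum>e\<in>{1..N div (v * f\<^sup>2)}. 1 / sqrt (real e)) \<le> 2 * sqrt (real N / real v) * inverse (real f)"
      by simp
  qed
  also have "\<dots> = 2 * sqrt (real N / real v) * harm N" by (simp add: harm_def sum_distrib_left)
  finally show ?thesis .
qed

definition dual_index :: "nat \<Rightarrow> (nat \<times> nat) set" where
  "dual_index H = (SIGMA h:{1..<H}. {..<2*h})"

definition dual_freq :: "nat \<times> nat \<Rightarrow> real" where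
  "dual_freq = (\<lambda>(h, n). frac (real n ^ 2 / (4 * real h)))"

text \<open>The large sieve wants distinct frequencies, so the weights of all pairs (h, n) that
  share a frequency are collected in one coefficient.\<close>

definition dual_coeff :: "(nat \<Rightarrow> real) \<Rightarrow> nat \<Rightarrow> real \<Rightarrow> real" where
  "dual_coeff wt H x = (\<Sum>p\<in>{p\<in>dual_index H. dual_freq p = x}. wt (fst p))"

lemma finite_dual_index [simp]: "finite (dual_index H)"
  by (simp add: dual_index_def)

context
  fixes wt :: "nat \<Rightarrow> real" and H :: nat
  assumes wt: "\<And>h. h \<in> {1..<H} \<Longrightarrow> 0 \<le> wt h \<and> wt h \<le> 1 / sqrt (real h)"
begin

lemma dual_coeff_nonneg: "dual_coeff wt H x \<ge> 0"
  unfolding dual_coeff_def using wt by (intro sum_nonneg) (auto simp: dual_index_def)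

text \<open>Pairs (h, n) of frequency u/v in lowest terms come from triples (e, f, x) with 4h = v e
  f^2. The weight is at most 1/sqrt h = 2/(f sqrt(v e)), and there are f times
  \<open>root_count v e u\<close> values of x, so the factor f cancels.\<close>

lemma dual_coeff_le:
  assumes "v > 0" "u < v" "coprime u v"
  shows "dual_coeff wt H (real u / real v) \<le>
     2 / sqrt (real v) * (\<Sum>(e, f)\<in>square_factorizations v (4 * H). 1 / sqrt (real e) * real (root_count v e u))"
proof -
  define P where "P = square_factorizations v (4 * H)"
  define X where "X = (\<lambda>(e, f). {x. x < v * f \<and> e * x\<^sup>2 mod v = u})"
  have finP: "finite P" using assms by (simp add: P_def finite_square_factorizations)
  have finX: "finite (X p)" for p by (auto simp: X_def case_prod_unfold)
  have "dual_coeff wt H (real u / real v) \<le>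
     (\<Sum>(p, x)\<in>(SIGMA p:P. X p). 2 / (real (snd p) * sqrt (real v) * sqrt (real (fst p))))"
    unfolding dual_coeff_def
  \<comment> \<open>The map recovers (h, n) from a triple; the division by 4 is exact on the triples
    that come from a pair.\<close>
  proof (rule sum_le_included[where i = "\<lambda>((e, f), x). (v * e * f\<^sup>2 div 4, e * f * x)"])
    show "\<forall>p\<in>{p \<in> dual_index H. dual_freq p = real u / real v}. \<exists>y\<in>SIGMA p:P. X p.
       (\<lambda>((e, f), x). (v * e * f\<^sup>2 div 4, e * f * x)) y = p \<and>
       wt (fst p) \<le> (case y of (p, x) \<Rightarrow> 2 / (real (snd p) * sqrt (real v) * sqrt (real (fst p))))"
    proof
      fix p assume "p \<in> {p \<in> dual_index H. dual_freq p = real u / real v}"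
      then obtain h n where p: "p = (h, n)" and hn: "(h, n) \<in> dual_index H" "dual_freq (h, n) = real u / real v"
        by (cases p) auto
      hence h: "h \<in> {1..<H}" "h > 0" "n < 2 * h" by (auto simp: dual_index_def)
      obtain e f x where efx: "e > 0" "f > 0" "4 * h = v * e * f\<^sup>2" "n = e * f * x" "x < v * f" "e * x\<^sup>2 mod v = u"
        using frac_square_eq_imp_param[of v h u n] assms h hn(2) by (auto simp: dual_freq_def)
      have "(e, f) \<in> P" using efx h by (auto simp: P_def square_factorizations_def simp flip: efx(3))
      moreover have "x \<in> X (e, f)" using efx by (simp add: X_def)
      moreover have "wt h \<le> 2 / (real f * sqrt (real v) * sqrt (real e))"
      proof -
        have "real h = (real f * sqrt (real v) * sqrt (real e) / 2)\<^sup>2"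
          using arg_cong[OF efx(3), of real] by (simp add: power_mult_distrib power_divide mult_ac)
        hence "sqrt (real h) = real f * sqrt (real v) * sqrt (real e) / 2" by simp
        hence "1 / sqrt (real h) = 2 / (real f * sqrt (real v) * sqrt (real e))" by (simp only: divide_divide_eq_right mult_1)
        thus ?thesis using wt[OF h(1)] by simp
      qed
      moreover have "v * e * f\<^sup>2 div 4 = h" by (simp flip: efx(3))
      ultimately show "\<exists>y\<in>SIGMA p:P. X p.
       (\<lambda>((e, f), x). (v * e * f\<^sup>2 div 4, e * f * x)) y = p \<and>
       wt (fst p) \<le> (case y of (p, x) \<Rightarrow> 2 / (real (snd p) * sqrt (real v) * sqrt (real (fst p))))"
        using efx by (intro bexI[of _ "((e, f), x)"]) (auto simp: p)
    qed
    show "finite (SIGMA p:P. X p)" using finP finX by auto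
  qed auto
  also have "\<dots> = (\<Sum>p\<in>P. \<Sum>x\<in>X p. 2 / (real (snd p) * sqrt (real v) * sqrt (real (fst p))))"
    using finP finX by (subst sum.Sigma) auto
  also have "\<dots> = (\<Sum>(e, f)\<in>P. 2 / sqrt (real v) * (1 / sqrt (real e) * real (root_count v e u)))"
  proof (rule sum.cong, rule refl, clarify)
    fix e f assume "(e, f) \<in> P"
    hence f: "f > 0" by (simp add: P_def square_factorizations_def)
    have "card (X (e, f)) = card {x. x < v * f \<and> e * (x mod v)\<^sup>2 mod v = u}"
    proof -
      have "e * (x mod v)\<^sup>2 mod v = e * x\<^sup>2 mod v" for x
        using mod_mult_right_eq[of e "(x mod v)\<^sup>2" v] mod_mult_right_eq[of e "x\<^sup>2" v] power_mod[of x v 2] by simp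
      thus ?thesis by (simp add: X_def)
    qed
    also have "\<dots> = f * root_count v e u" unfolding root_count_def by (rule card_mod_eq_count)
    finally show "(\<Sum>x\<in>X (e, f). 2 / (real (snd (e, f)) * sqrt (real v) * sqrt (real (fst (e, f))))) =
       2 / sqrt (real v) * (1 / sqrt (real e) * real (root_count v e u))"
      using f by simp
  qed
  finally show ?thesis by (simp add: P_def sum_distrib_left case_prod_unfold)
qed

text \<open>Cauchy-Schwarz with the weights 1/sqrt e lets the sum over u act on the squares of the
  root counts alone, whose second moment is bounded independently of e. The constant is 256 = 16 *
  2^2 * 4, the last factor coming from N = 4H.\<close>

lemma sum_coprime_dual_coeff_square_le:
  assumes "v > 0"
  shows "(\<Sum>u | u < v \<and> coprime u v. (dual_coeff wt H (real u / real v))\<^sup>2) \<le>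
     256 * real H * (harm (4 * H))\<^sup>2 * (real (card {d. d dvd v}) / real v)"
proof -
  define P where "P = square_factorizations v (4 * H)"
  define B where "B = (\<Sum>(e, f)\<in>P. 1 / sqrt (real e))"
  define U where "U = {u. u < v \<and> coprime u v}"
  have B0: "B \<ge> 0" unfolding B_def by (intro sum_nonneg) auto
  have "(\<Sum>u\<in>U. (dual_coeff wt H (real u / real v))\<^sup>2) \<le>
     (\<Sum>u\<in>U. 4 / real v * (B * (\<Sum>(e, f)\<in>P. 1 / sqrt (real e) * (real (root_count v e u))\<^sup>2)))"
  proof (rule sum_mono)
    fix u assume u: "u \<in> U"
    have "(dual_coeff wt H (real u / real v))\<^sup>2 \<le>
       (2 / sqrt (real v) * (\<Sum>p\<in>P. 1 / sqrt (real (fst p)) * real (root_count v (fst p) u)))\<^sup>2"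
      using dual_coeff_le[OF assms, of u] u
      by (intro power_mono dual_coeff_nonneg) (auto simp: U_def P_def case_prod_unfold)
    also have "\<dots> = 4 / real v * (\<Sum>p\<in>P. 1 / sqrt (real (fst p)) * real (root_count v (fst p) u))\<^sup>2"
      by (simp add: power_mult_distrib power_divide)
    also have "\<dots> \<le> 4 / real v * ((\<Sum>p\<in>P. 1 / sqrt (real (fst p))) *
        (\<Sum>p\<in>P. 1 / sqrt (real (fst p)) * (real (root_count v (fst p) u))\<^sup>2))"
      by (intro mult_left_mono weighted_Cauchy_Schwarz) auto
    finally show "(dual_coeff wt H (real u / real v))\<^sup>2 \<le>
       4 / real v * (B * (\<Sum>(e, f)\<in>P. 1 / sqrt (real e) * (real (root_count v e u))\<^sup>2))"
      by (simp add: B_def case_prod_unfold)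
  qed
  also have "\<dots> = 4 / real v * (B * (\<Sum>(e, f)\<in>P. 1 / sqrt (real e) * (\<Sum>u\<in>U. (real (root_count v e u))\<^sup>2)))"
    unfolding case_prod_unfold sum_distrib_left by (subst sum.swap) (rule refl)
  also have "\<dots> \<le> 4 / real v * (B * (\<Sum>(e, f)\<in>P. 1 / sqrt (real e) * (4 * real v * real (card {d. d dvd v}))))"
  proof -
    have "(\<Sum>u\<in>U. (real (root_count v e u))\<^sup>2) \<le> 4 * real v * real (card {d. d dvd v})" for e
    proof -
      have "(\<Sum>u\<in>U. (root_count v e u)\<^sup>2) \<le> 4 * v * card {d. d dvd v}"
        unfolding U_def using sum_root_count_square_le card_square_pairs_le[OF assms] by (rule order.trans)
      hence "real (\<Sum>u\<in>U. (root_count v e u)\<^sup>2) \<le> real (4 * v * card {d. d dvd v})"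
        by (simp only: of_nat_le_iff)
      thus ?thesis by simp
    qed
    hence "(\<Sum>p\<in>P. 1 / sqrt (real (fst p)) * (\<Sum>u\<in>U. (real (root_count v (fst p) u))\<^sup>2)) \<le>
        (\<Sum>p\<in>P. 1 / sqrt (real (fst p)) * (4 * real v * real (card {d. d dvd v})))"
      by (intro sum_mono mult_left_mono) auto
    thus ?thesis unfolding case_prod_unfold using B0 by (intro mult_left_mono) auto
  qed
  also have "\<dots> = 16 * B\<^sup>2 * real (card {d. d dvd v})"
    using assms unfolding case_prod_unfold sum_distrib_right[symmetric] 
    by (simp add: B_def case_prod_unfold power2_eq_square)
  also have "\<dots> \<le> 16 * (2 * sqrt (real (4 * H) / real v) * harm (4 * H))\<^sup>2 * real (card {d. d dvd v})"
    using sum_square_factorizations_le[OF assms, of "4 * H"] B0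
    by (intro mult_right_mono mult_left_mono power_mono) (auto simp: B_def P_def)
  also have "\<dots> = 256 * real H * (harm (4 * H))\<^sup>2 * (real (card {d. d dvd v}) / real v)"
    by (simp add: power_mult_distrib)
  finally show ?thesis by (simp add: U_def)
qed

lemma dual_freq_eq_fraction:
  assumes "p \<in> dual_index H"
  obtains v u where "v \<in> {1..4*H}" "u < v" "coprime u v" "dual_freq p = real u / real v"
proof -
  obtain h n where p: "p = (h, n)" "h \<in> {1..<H}" "n < 2 * h" using assms by (auto simp: dual_index_def)
  define a where "a = n\<^sup>2 mod (4 * h)"
  have "frac (real n ^ 2 / (4 * real h)) = real a / real (4 * h)"
  proof -
    have "real n ^ 2 / (4 * real h) = real (n\<^sup>2 div (4 * h)) + real a / real (4 * h)"
    proof -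
      have "real (n\<^sup>2) = real (n\<^sup>2 div (4 * h) * (4 * h) + a)" unfolding a_def by (simp only: div_mult_mod_eq)
      thus ?thesis using p by (simp add: field_simps del: div_mult_mod_eq)
    qed
    moreover have "a < 4 * h" using p by (simp add: a_def)
    hence "real a < real (4 * h)" by (simp only: of_nat_less_iff)
    hence "real a / real (4 * h) < 1" using p by (simp add: field_simps)
    ultimately show ?thesis by (simp add: frac_unique_iff)
  qed
  moreover have "gcd a (4 * h) \<noteq> 0" using p by simp
  then obtain u v where uv: "a = u * gcd a (4 * h)" "4 * h = v * gcd a (4 * h)" "coprime u v"
    using gcd_coprime_exists by blast
  define g where "g = gcd a (4 * h)"
  have g: "g > 0" "a = u * g" "4 * h = v * g" using uv p by (auto simp: g_def)
  have "u < v"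
  proof -
    have "a < 4 * h" using p by (simp add: a_def)
    thus ?thesis using g by simp
  qed
  moreover have "v \<le> 4 * h" using g by simp
  moreover have "real a / real (4 * h) = real u / real v" using g by simp
  ultimately show thesis using p uv(3) by (intro that[of v u]) (auto simp: dual_freq_def)
qed

text \<open>If all frequencies were different, the sum would be at most the sum of 2h * (1/h) over h
  < H, hence at most 2H. The estimate says that coincidences between frequencies cost only
  logarithms.\<close>

lemma sum_dual_coeff_square_le:
  "(\<Sum>x\<in>dual_freq ` dual_index H. (dual_coeff wt H x)\<^sup>2) \<le> 256 * real H * harm (4 * H) ^ 4"
proof -
  have "(\<Sum>x\<in>dual_freq ` dual_index H. (dual_coeff wt H x)\<^sup>2) \<le>
     (\<Sum>(v, u)\<in>(SIGMA v:{1..4*H}. {u. u < v \<and> coprime u v}). (dual_coeff wt H (real u / real v))\<^sup>2)"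
  proof (rule sum_le_included[where i = "\<lambda>(v, u). real u / real v"])
    show "\<forall>x\<in>dual_freq ` dual_index H. \<exists>y\<in>SIGMA v:{1..4 * H}. {u. u < v \<and> coprime u v}.
       (case y of (v, u) \<Rightarrow> real u / real v) = x \<and>
       (dual_coeff wt H x)\<^sup>2 \<le> (case y of (v, u) \<Rightarrow> (dual_coeff wt H (real u / real v))\<^sup>2)"
    proof
      fix x assume "x \<in> dual_freq ` dual_index H"
      then obtain p where p: "p \<in> dual_index H" "x = dual_freq p" by auto
      obtain v u where "v \<in> {1..4*H}" "u < v" "coprime u v" "x = real u / real v"
        by (rule dual_freq_eq_fraction[OF p(1)]) (simp add: p(2))
      thus "\<exists>y\<in>SIGMA v:{1..4 * H}. {u. u < v \<and> coprime u v}.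
       (case y of (v, u) \<Rightarrow> real u / real v) = x \<and>
       (dual_coeff wt H x)\<^sup>2 \<le> (case y of (v, u) \<Rightarrow> (dual_coeff wt H (real u / real v))\<^sup>2)"
        by (intro bexI[of _ "(v, u)"]) auto
    qed
  qed auto
  also have "\<dots> = (\<Sum>v\<in>{1..4*H}. \<Sum>u | u < v \<and> coprime u v. (dual_coeff wt H (real u / real v))\<^sup>2)"
    by (subst sum.Sigma) auto
  also have "\<dots> \<le> (\<Sum>v\<in>{1..4*H}. 256 * real H * (harm (4 * H))\<^sup>2 * (real (card {d. d dvd v}) / real v))"
    by (intro sum_mono sum_coprime_dual_coeff_square_le) auto
  also have "\<dots> = 256 * real H * (harm (4 * H))\<^sup>2 * (\<Sum>v\<in>{1..4*H}. real (card {d. d dvd v}) / real v)"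
    by (simp add: sum_distrib_left)
  also have "\<dots> \<le> 256 * real H * (harm (4 * H))\<^sup>2 * (harm (4 * H))\<^sup>2"
    by (intro mult_left_mono sum_divisor_count_div_le) auto
  finally show ?thesis by (simp add: power4_eq_xxxx power2_eq_square mult_ac)
qed

text \<open>Distinct fractions with denominators at most 4H differ modulo 1 by at least 1/(16 H^2),
  which is the separation for the large sieve. Passing to the complex conjugate removes the minus
  sign in the phases.\<close>

lemma dual_sum_mean_square:
  fixes w :: "nat \<Rightarrow> real"
  assumes w: "\<And>q. q \<ge> A \<Longrightarrow> w (Suc q) \<le> w q" "\<And>q. q \<ge> A \<Longrightarrow> w q \<ge> 0"
  shows "(\<Sum>q=A..<B. w q * norm (\<Sum>h=1..<H. of_real (wt h) * (\<Sum>n<2*h. ee (- (real n ^ 2 * real q / (4 * real h))))) ^ 2) \<le>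
     ((\<Sum>q=A..<B. w q) + w A * (real (16 * H\<^sup>2) * harm (16 * H\<^sup>2))) * (256 * real H * harm (4 * H) ^ 4)"
proof (cases "H = 0")
  case False
  define R where "R = dual_freq ` dual_index H"
  have T: "norm (\<Sum>h=1..<H. of_real (wt h) * (\<Sum>n<2*h. ee (- (real n ^ 2 * real q / (4 * real h))))) =
      norm (\<Sum>x\<in>R. of_real (dual_coeff wt H x) * ee (real q * x))" for q
  proof -
    have "(\<Sum>x\<in>R. of_real (dual_coeff wt H x) * ee (real q * x)) =
       (\<Sum>x\<in>R. \<Sum>p\<in>{p\<in>dual_index H. dual_freq p = x}. of_real (wt (fst p)) * ee (real q * dual_freq p))"
      unfolding dual_coeff_def of_real_sum sum_distrib_right by (intro sum.cong) auto
    also have "\<dots> = (\<Sum>p\<in>dual_index H. of_real (wt (fst p)) * ee (real q * dual_freq p))"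
      unfolding R_def by (rule sum.image_gen[symmetric]) simp
    also have "\<dots> = (\<Sum>(h, n)\<in>dual_index H. of_real (wt h) * ee (real n ^ 2 * real q / (4 * real h)))"
    proof (rule sum.cong, rule refl, clarify)
      fix h n
      define y where "y = real n ^ 2 / (4 * real h)"
      have "real q * frac y = real q * y + of_int (- (int q * \<lfloor>y\<rfloor>))" by (simp add: frac_def algebra_simps)
      hence "ee (real q * frac y) = ee (real q * y)" by (simp only: ee_add_of_int)
      thus "of_real (wt (fst (h, n))) * ee (real q * dual_freq (h, n)) = of_real (wt h) * ee (real n ^ 2 * real q / (4 * real h))"
        by (simp add: dual_freq_def y_def mult_ac)
    qed
    also have "\<dots> = (\<Sum>h=1..<H. \<Sum>n<2*h. of_real (wt h) * ee (real n ^ 2 * real q / (4 * real h)))"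
      unfolding dual_index_def by (subst sum.Sigma) auto
    also have "\<dots> = cnj (\<Sum>h=1..<H. of_real (wt h) * (\<Sum>n<2*h. ee (- (real n ^ 2 * real q / (4 * real h)))))"
      by (simp add: ee_uminus sum_distrib_left)
    finally have eq: "(\<Sum>x\<in>R. of_real (dual_coeff wt H x) * ee (real q * x)) =
      cnj (\<Sum>h=1..<H. of_real (wt h) * (\<Sum>n<2*h. ee (- (real n ^ 2 * real q / (4 * real h)))))" .
    show ?thesis unfolding eq complex_mod_cnj ..
  qed
  have "(\<Sum>q=A..<B. w q * norm (\<Sum>x\<in>R. of_real (dual_coeff wt H x) * ee (real q * x)) ^ 2) \<le>
     ((\<Sum>q=A..<B. w q) + w A * (real (16 * H\<^sup>2) * harm (16 * H\<^sup>2))) * (\<Sum>x\<in>R. dual_coeff wt H x ^ 2)"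
  proof (rule weighted_large_sieve)
    show "finite R" by (simp add: R_def)
    show "R \<subseteq> {0..<1}" by (auto simp: R_def dual_freq_def frac_lt_1)
    show "16 * H\<^sup>2 > 0" using False by simp
    fix x y assume xy: "x \<in> R" "y \<in> R" "x < y"
    from xy(1) obtain p1 where p1: "p1 \<in> dual_index H" "x = dual_freq p1" unfolding R_def by blast
    obtain v u where v: "v \<in> {1..4*H}" "u < v" "x = real u / real v"
      by (rule dual_freq_eq_fraction[OF p1(1)]) (simp add: p1(2))
    from xy(2) obtain p2 where p2: "p2 \<in> dual_index H" "y = dual_freq p2" unfolding R_def by blast
    obtain v' u' where v': "v' \<in> {1..4*H}" "u' < v'" "y = real u' / real v'"
      by (rule dual_freq_eq_fraction[OF p2(1)]) (simp add: p2(2))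
    have pos: "real v > 0" "real v' > 0" using v v' by auto
    have le: "real v * real v' \<le> real (16 * H\<^sup>2)"
    proof -
      have "v * v' \<le> (4 * H) * (4 * H)" using v v' by (intro mult_mono) auto
      also have "\<dots> = 16 * H\<^sup>2" by (simp add: power2_eq_square)
      finally show ?thesis by (simp flip: of_nat_mult)
    qed
    have le': "1 / real (16 * H\<^sup>2) \<le> 1 / (real v * real v')" using le pos False by (intro divide_left_mono mult_pos_pos) auto
    have "u * v' < u' * v"
    proof -
      have "real u * real v' < real u' * real v" using xy(3) pos unfolding v v' by (simp add: field_simps)
      thus ?thesis by (simp flip: of_nat_mult)
    qed
    hence "real (u * v') + 1 \<le> real (u' * v)" by linarith
    hence 1: "1 / (real v * real v') \<le> y - x" using pos unfolding v v' by (simp add: field_simps)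
    have "Suc u' * v \<le> v' * v" using v' by (intro mult_right_mono) auto
    hence "u' * v + 1 \<le> v' * v + u * v'" using v by simp
    hence "real (u' * v + 1) \<le> real (v' * v + u * v')" by (simp only: of_nat_le_iff)
    hence 2: "1 / (real v * real v') \<le> 1 - (y - x)" using pos unfolding v v' by (simp add: field_simps)
    show "1 / real (16 * H\<^sup>2) \<le> y - x \<and> y - x \<le> 1 - 1 / real (16 * H\<^sup>2)"
      using 1 2 le' by linarith
  qed (use w in auto)
  also have "\<dots> \<le> ((\<Sum>q=A..<B. w q) + w A * (real (16 * H\<^sup>2) * harm (16 * H\<^sup>2))) * (256 * real H * harm (4 * H) ^ 4)"
    unfolding R_def
    by (intro mult_left_mono sum_dual_coeff_square_le add_nonneg_nonneg sum_nonneg mult_nonneg_nonneg)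
       (use w in \<open>auto simp: harm_nonneg\<close>)
  finally show ?thesis unfolding T .
qed auto

end

section \<open>Counting squares near multiples of an integer\<close>

text \<open>Nonnegativity of the left side allows a sum over selected residues to be extended to all
  residues, while the right side involves only frequencies below H. In the induction, the new power
  \<open>z ^ H\<close> contributes each of z, ..., z^H once as a cross term.\<close>

lemma fejer_kernel_eq:
  fixes z :: complex
  assumes "norm z = 1"
  shows "norm (\<Sum>j<H. z ^ j) ^ 2 = real H + 2 * Re (\<Sum>h=1..<H. of_real (real H - real h) * z ^ h)"
proof (induction H)
  case (Suc H)
  have zz: "z * cnj z = 1" using assms complex_norm_square[of z] by simp
  have "cnj (\<Sum>j<H. z ^ j) * z ^ H = (\<Sum>j<H. z ^ (H - j))"
  proof -
    have "cnj z ^ j * z ^ H = z ^ (H - j)" if "j < H" for j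
    proof -
      have "z ^ H = z ^ j * z ^ (H - j)" using that by (simp flip: power_add)
      moreover have "cnj z ^ j * z ^ j = 1" using zz by (simp add: mult.commute flip: power_mult_distrib)
      ultimately show ?thesis by (simp flip: mult.assoc)
    qed
    thus ?thesis by (simp add: sum_distrib_right)
  qed
  also have "\<dots> = (\<Sum>h=1..<Suc H. z ^ h)"
    by (rule sum.reindex_bij_witness[of _ "\<lambda>h. H - h" "\<lambda>j. H - j"]) auto
  finally have c: "cnj (\<Sum>j<H. z ^ j) * z ^ H = (\<Sum>h=1..<Suc H. z ^ h)" .
  have "norm (\<Sum>j<Suc H. z ^ j) ^ 2 = norm (\<Sum>j<H. z ^ j) ^ 2 + norm (z ^ H) ^ 2 + 2 * Re (cnj (\<Sum>j<H. z ^ j) * z ^ H)"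
  proof -
    have "norm (S + w) ^ 2 = norm S ^ 2 + norm w ^ 2 + 2 * Re (cnj S * w)" for S w :: complex
      unfolding cmod_power2 by (simp add: power2_eq_square algebra_simps)
    thus ?thesis unfolding sum.lessThan_Suc by blast
  qed
  also have "\<dots> = real H + 2 * Re (\<Sum>h=1..<H. of_real (real H - real h) * z ^ h) + 1 + 2 * Re (\<Sum>h=1..<Suc H. z ^ h)"
    unfolding Suc.IH c using assms by (simp add: norm_power)
  also have "\<dots> = real (Suc H) + 2 * Re (\<Sum>h=1..<Suc H. of_real (real (Suc H) - real h) * z ^ h)"
  proof -
    have "(\<Sum>h=1..<Suc H. of_real (real (Suc H) - real h) * z ^ h) =
      (\<Sum>h=1..<Suc H. of_real (real H - real h) * z ^ h) + (\<Sum>h=1..<Suc H. z ^ h)"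
      by (simp add: algebra_simps flip: sum.distrib)
    also have "(\<Sum>h=1..<Suc H. of_real (real H - real h) * z ^ h) = (\<Sum>h=1..<H. of_real (real H - real h) * z ^ h)"
      by (cases H) auto
    finally show ?thesis by simp
  qed
  finally show ?case .
qed auto

text \<open>The constant 6 keeps the phases j x, j < H, within a sixth of a turn from an integer,
  where the cosine is at least cos(pi/3) = 1/2; so no cancellation occurs in the real part.\<close>

lemma norm_ee_sum_ge:
  assumes "H > 0" "nearest_int_dist x \<le> 1 / (6 * real H)"
  shows "norm (\<Sum>j<H. ee x ^ j) \<ge> real H / 2"
proof -
  define y where "y = x - of_int (round x)"
  have y: "\<bar>y\<bar> \<le> 1 / (6 * real H)" using assms(2) by (simp add: y_def nearest_int_dist_def)
  have ee_y: "ee x = ee y" using ee_add_of_int[of y "round x"] by (simp add: y_def)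
  have "Re (ee y ^ j) \<ge> 1 / 2" if "j < H" for j
  proof -
    have "ee y ^ j = ee (real j * y)" by (simp add: ee_mult_of_nat)
    hence "Re (ee y ^ j) = cos \<bar>2 * pi * (real j * y)\<bar>" by (simp add: ee_def)
    also have "\<dots> \<ge> cos (pi / 3)"
    proof (rule cos_monotone_0_pi_le)
      have "\<bar>real j * y\<bar> \<le> real H * (1 / (6 * real H))"
        unfolding abs_mult using y that by (intro mult_mono) auto
      also have "\<dots> = 1 / 6" using assms(1) by simp
      finally have "2 * pi * \<bar>real j * y\<bar> \<le> 2 * pi * (1 / 6)" by (intro mult_left_mono) auto
      thus "\<bar>2 * pi * (real j * y)\<bar> \<le> pi / 3" by (simp add: abs_mult)
    qed auto
    finally show ?thesis by (simp add: cos_60)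
  qed
  hence "(\<Sum>j<H. 1 / 2) \<le> (\<Sum>j<H. Re (ee y ^ j))" by (intro sum_mono) auto
  also have "\<dots> \<le> norm (\<Sum>j<H. ee y ^ j)" using complex_Re_le_cmod[of "\<Sum>j<H. ee y ^ j"] by simp
  finally show ?thesis by (simp add: ee_y)
qed

text \<open>The weight is the Fejer weight 1 - h/H times the factor 1/sqrt h from reciprocity. The
  factors H and sqrt q are taken out, so q enters only through the phases, as the large sieve
  requires.\<close>

definition dual_sum :: "nat \<Rightarrow> nat \<Rightarrow> complex" where
  "dual_sum H q = (\<Sum>h=1..<H. of_real ((1 - real h / real H) / sqrt (real h)) *
     (\<Sum>n<2*h. ee (- (real n ^ 2 * real q / (4 * real h)))))"

definition near_square_residues :: "nat \<Rightarrow> real \<Rightarrow> nat set" where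
  "near_square_residues q \<delta> = {a. a < q \<and> nearest_int_dist (real a ^ 2 / real q) \<le> \<delta>}"

lemma card_near_square_residues_le:
  "\<exists>C>0. \<forall>H q. H > 0 \<longrightarrow> q > 0 \<longrightarrow>
     real (card (near_square_residues q (1 / (6 * real H)))) \<le> C * (real q + norm (dual_sum H q) ^ 2) / real H"
proof -
  obtain \<kappa> where \<kappa>: "\<And>h q. h > 0 \<Longrightarrow> q > 0 \<Longrightarrow>
     (\<Sum>a<q. ee (real h * real a ^ 2 / real q)) =
     \<kappa> * of_real (sqrt (real q / real h)) * (\<Sum>r<2*h. ee (- (real r ^ 2 * real q / (4 * real h))))"
    using landsberg_schaar by blast
  have "real (card (near_square_residues q (1 / (6 * real H)))) \<le>
      (4 * (1 + norm \<kappa>)) * (real q + norm (dual_sum H q) ^ 2) / real H" if H: "H > 0" and q: "q > 0" for H q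
  proof -
    define S where "S = near_square_residues q (1 / (6 * real H))"
    define T where "T = norm (dual_sum H q)"
    define K where "K = (\<lambda>a. norm (\<Sum>j<H. ee (real a ^ 2 / real q) ^ j) ^ 2)"
    have fin: "S \<subseteq> {..<q}" by (auto simp: S_def near_square_residues_def)
    have "(real H / 2) ^ 2 * real (card S) = (\<Sum>a\<in>S. (real H / 2) ^ 2)" by simp
    also have "\<dots> \<le> (\<Sum>a\<in>S. K a)"
      unfolding K_def using H by (intro sum_mono power_mono norm_ee_sum_ge) (auto simp: S_def near_square_residues_def)
    also have "\<dots> \<le> (\<Sum>a<q. K a)" using fin by (intro sum_mono2) (auto simp: K_def)
    also have "\<dots> = (\<Sum>a<q. real H + 2 * Re (\<Sum>h=1..<H. of_real (real H - real h) * ee (real a ^ 2 / real q) ^ h))"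
      unfolding K_def by (intro sum.cong refl fejer_kernel_eq) simp
    also have "\<dots> = real q * real H + 2 * Re (\<Sum>h=1..<H. of_real (real H - real h) * (\<Sum>a<q. ee (real a ^ 2 / real q) ^ h))"
      unfolding sum_distrib_left
      by (subst sum.swap) (simp add: sum.distrib sum_distrib_left)
    also have "(\<Sum>h=1..<H. of_real (real H - real h) * (\<Sum>a<q. ee (real a ^ 2 / real q) ^ h)) =
        of_real (real H) * \<kappa> * of_real (sqrt (real q)) * dual_sum H q"
      unfolding dual_sum_def sum_distrib_left[of "of_real (real H) * \<kappa> * of_real (sqrt (real q))"]
    proof (rule sum.cong, rule refl)
      fix h assume h: "h \<in> {1..<H}"
      have 1: "(\<Sum>a<q. ee (real a ^ 2 / real q) ^ h) = (\<Sum>a<q. ee (real h * real a ^ 2 / real q))"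
        by (simp flip: ee_mult_of_nat)
      have 2: "complex_of_real (real H - real h) * of_real (sqrt (real q / real h)) =
         of_real (real H) * of_real (sqrt (real q)) * of_real ((1 - real h / real H) / sqrt (real h))"
      proof -
        have "(real H - real h) * sqrt (real q / real h) = real H * sqrt (real q) * ((1 - real h / real H) / sqrt (real h))"
          using H h by (simp add: real_sqrt_divide field_simps)
        from arg_cong[OF this, of complex_of_real] show ?thesis by (simp only: of_real_mult)
      qed
      have "complex_of_real (real H - real h) * (\<Sum>a<q. ee (real a ^ 2 / real q) ^ h) =
         \<kappa> * (complex_of_real (real H - real h) * of_real (sqrt (real q / real h))) * (\<Sum>r<2*h. ee (- (real r ^ 2 * real q / (4 * real h))))"
        unfolding 1 using \<kappa>[of h q] h q by simp
      thus "complex_of_real (real H - real h) * (\<Sum>a<q. ee ((real a)\<^sup>2 / real q) ^ h) =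
         of_real (real H) * \<kappa> * of_real (sqrt (real q)) * (of_real ((1 - real h / real H) / sqrt (real h)) * (\<Sum>n<2 * h. ee (- ((real n)\<^sup>2 * real q / (4 * real h)))))"
        unfolding 2 by (simp only: mult_ac)
    qed
    also have "Re (of_real (real H) * \<kappa> * of_real (sqrt (real q)) * dual_sum H q) \<le> real H * norm \<kappa> * sqrt (real q) * T"
      by (rule order.trans[OF complex_Re_le_cmod]) (simp add: norm_mult T_def)
    also have "2 * (real H * norm \<kappa> * sqrt (real q) * T) = real H * norm \<kappa> * (2 * sqrt (real q) * T)" by simp
    \<comment> \<open>This trades the remainder sqrt(q) T for the expected size q plus T^2, so that
      a bound for the mean square of T is all that is needed later.\<close>
    also have "2 * sqrt (real q) * T \<le> real q + T ^ 2"
      using sum_squares_bound[of "sqrt (real q)" T] by simp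
    finally have "(real H / 2) ^ 2 * real (card S) \<le> real q * real H + real H * norm \<kappa> * (real q + T\<^sup>2)"
      by (simp add: mult_left_mono)
    also have "\<dots> \<le> real H * ((1 + norm \<kappa>) * (real q + T\<^sup>2))"
      using H by (simp add: algebra_simps)
    finally have "real H * (real H * real (card S)) \<le> real H * (4 * (1 + norm \<kappa>) * (real q + T\<^sup>2))"
      by (simp add: power2_eq_square algebra_simps)
    hence "real H * real (card S) \<le> 4 * (1 + norm \<kappa>) * (real q + T\<^sup>2)" using H by (simp only: mult_le_cancel_left_pos of_nat_0_less_iff)
    thus ?thesis using H by (simp add: S_def T_def field_simps)
  qed
  thus ?thesis by (intro exI[of _ "4 * (1 + norm \<kappa>)"]) (auto simp: add_pos_nonneg)
qed

lemma dual_weight_bounds: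
  assumes "h \<in> {1..<H}"
  shows "0 \<le> (1 - real h / real H) / sqrt (real h) \<and> (1 - real h / real H) / sqrt (real h) \<le> 1 / sqrt (real h)"
  using assms by (auto simp: divide_right_mono)

text \<open>Trivial estimate: the inner sum has 2h terms, so the sum is at most 2 H^(3/2). Once q >=
  H^3 its square is at most 4q, the size of the expected term; hence the dyadic blocks end at
  H^3.\<close>

lemma norm_dual_sum_square_le: "norm (dual_sum H q) ^ 2 \<le> 4 * real H ^ 3"
proof -
  have "norm (dual_sum H q) \<le> (\<Sum>h=1..<H. 1 / sqrt (real h) * (2 * real h))"
    unfolding dual_sum_def
  proof (intro order.trans[OF norm_sum] sum_mono)
    fix h assume h: "h \<in> {1..<H}"
    have "norm (\<Sum>n<2*h. ee (- (real n ^ 2 * real q / (4 * real h)))) \<le> (\<Sum>n<2*h. 1)"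
      by (intro order.trans[OF norm_sum] sum_mono) simp
    thus "norm (of_real ((1 - real h / real H) / sqrt (real h)) * (\<Sum>n<2*h. ee (- (real n ^ 2 * real q / (4 * real h))))) \<le>
       1 / sqrt (real h) * (2 * real h)"
      unfolding norm_mult norm_of_real using dual_weight_bounds[OF h]
      by (intro mult_mono) auto
  qed
  also have "\<dots> \<le> (\<Sum>h=1..<H. 2 * sqrt (real H))"
  proof (rule sum_mono)
    fix h assume "h \<in> {1..<H}"
    moreover have "1 / sqrt (real h) * (2 * real h) = 2 * (real h / sqrt (real h))" by simp
    ultimately show "1 / sqrt (real h) * (2 * real h) \<le> 2 * sqrt (real H)"
      by (simp only: real_div_sqrt) auto
  qed
  also have "\<dots> \<le> 2 * real H * sqrt (real H)" by (auto simp: mult_right_mono)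
  finally have "norm (dual_sum H q) ^ 2 \<le> (2 * real H * sqrt (real H)) ^ 2" by (rule power_mono) auto
  also have "(2 * real H * sqrt (real H)) ^ 2 = 4 * real H ^ 3"
    by (simp add: power_mult_distrib) (simp add: power3_eq_cube power2_eq_square)
  finally show ?thesis .
qed

section \<open>Summation over dyadic ranges\<close>

lemma harm_double_le: "harm (2 * n) \<le> (harm n :: real) + 1"
proof (cases "n = 0")
  case False
  have "harm (2 * n) = (harm n :: real) + (\<Sum>k\<in>{n<..2*n}. inverse (real k))"
  proof -
    have "{1..2*n} = {1..n} \<union> {n<..2*n}" by auto
    thus ?thesis unfolding harm_def by (simp only:) (rule sum.union_disjoint, auto)
  qed
  also have "(\<Sum>k\<in>{n<..2*n}. inverse (real k)) \<le> (\<Sum>k\<in>{n<..2*n}. inverse (real n))"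
    using False by (intro sum_mono le_imp_inverse_le) auto
  also have "\<dots> = 1" using False by simp
  finally show ?thesis by simp
qed (simp add: harm_expand)

lemma harm_power2_le: "(harm (2 ^ k) :: real) \<le> real k + 1"
proof (induction k)
  case (Suc k)
  thus ?case using harm_double_le[of "2 ^ k"] by simp
qed (simp add: harm_expand)

definition dyadic_lower :: "nat \<Rightarrow> nat" where
  "dyadic_lower j = nat \<lceil>(2 ^ j :: real) powr (3 / 2)\<rceil>"

text \<open>With H = 2^j, and up to logarithms, the total weight contributes H^(3-3s) * H and the
  separation term H^(-3s/2) * H^2 * H. The factor H^(-1-s) turns these into H^(3-4s) and H^(2-5s/2).
  For s > 11/13 both exponents are below -1/10, the second one since 2 - 55/26 = -3/26. The constant
  is 4352 = 256 * (1 + 16).\<close>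

lemma dyadic_block_le:
  assumes s: "11 / 13 < s" "s \<le> 1"
  shows "(\<Sum>q=dyadic_lower j..<(2 ^ j) ^ 3. real q powr (- s) * norm (dual_sum (2 ^ j) q) ^ 2) * (2 ^ j) powr (- 1 - s)
     \<le> 4352 * (3 * real j + 5) ^ 5 * 2 powr (- real j / 10)"
proof -
  define H :: nat where "H = 2 ^ j"
  define x where "x = real H"
  define A where "A = dyadic_lower j"
  \<comment> \<open>A common bound for the harmonic sums up to H^3, 16 H^2 and 4H, which are at most
    3j + 1, 2j + 5 and j + 3.\<close>
  define L where "L = 3 * real j + 5"
  have x: "x \<ge> 1" by (simp add: x_def H_def)
  have L: "L \<ge> 1" by (simp add: L_def)
  have xA: "x powr (3 / 2) \<le> real A" unfolding A_def dyadic_lower_def x_def H_def by simp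
  have x1: "1 \<le> x powr (3 / 2)" using x by (simp add: ge_one_powr_ge_zero)
  have A: "A \<ge> 1" using xA x1 by linarith
  define W where "W = (\<Sum>q=A..<H ^ 3. real q powr (- s))"
  have W: "W \<le> x powr (3 - 3 * s) * L"
  proof -
    have "W \<le> (\<Sum>q\<in>{1..H ^ 3}. real q powr (- s))"
      unfolding W_def using A by (intro sum_mono2) auto
    also have "\<dots> \<le> (\<Sum>q\<in>{1..H ^ 3}. x powr (3 - 3 * s) * inverse (real q))"
    proof (rule sum_mono)
      fix q assume q: "q \<in> {1..H ^ 3}"
      have "real q powr (- s) = real q powr (1 - s) * real q powr (-1)" by (simp only: powr_add[symmetric]) simp
      also have "real q powr (-1) = inverse (real q)" using q by (simp add: powr_minus)
      also have "real q powr (1 - s) \<le> real (H ^ 3) powr (1 - s)" using q s by (intro powr_mono2) auto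
      also have "real (H ^ 3) powr (1 - s) = x powr (3 - 3 * s)"
      proof -
        have "real (H ^ 3) = x powr 3" using x by (simp add: x_def)
        thus ?thesis by (simp add: powr_powr algebra_simps)
      qed
      finally show "real q powr (- s) \<le> x powr (3 - 3 * s) * inverse (real q)"
        by (simp add: mult_right_mono)
    qed
    also have "\<dots> = x powr (3 - 3 * s) * harm (H ^ 3)" by (simp add: harm_def sum_distrib_left)
    also have "harm (H ^ 3) \<le> L"
      using harm_power2_le[of "j * 3"] by (simp add: H_def L_def power_mult)
    finally show ?thesis using x by (simp add: mult_left_mono)
  qed
  have wA: "real A powr (- s) \<le> x powr (- (3 / 2) * s)"
  proof -
    have "real A powr (- s) \<le> (x powr (3 / 2)) powr (- s)"
      using xA x1 s by (intro powr_mono2') auto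
    thus ?thesis by (simp add: powr_powr)
  qed
  have h16: "harm (16 * H\<^sup>2) \<le> L"
  proof -
    have "16 * H\<^sup>2 = 2 ^ (4 + 2 * j)" by (simp add: H_def power_add power_even_eq)
    thus ?thesis using harm_power2_le[of "4 + 2 * j"] by (simp add: L_def)
  qed
  have h4: "harm (4 * H) \<le> L"
  proof -
    have "4 * H = 2 ^ (2 + j)" by (simp add: H_def power_add)
    thus ?thesis using harm_power2_le[of "2 + j"] by (simp add: L_def)
  qed
  have "(\<Sum>q=A..<H ^ 3. real q powr (- s) * norm (dual_sum H q) ^ 2) \<le>
      (W + real A powr (- s) * (real (16 * H\<^sup>2) * harm (16 * H\<^sup>2))) * (256 * real H * harm (4 * H) ^ 4)"
    unfolding dual_sum_def W_def
    by (rule dual_sum_mean_square[OF dual_weight_bounds]) (use A s in \<open>auto intro!: powr_mono2'\<close>)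
  also have "\<dots> \<le> (x powr (3 - 3 * s) * L + x powr (- (3 / 2) * s) * (real (16 * H\<^sup>2) * L)) * (256 * real H * L ^ 4)"
    using W wA h16 h4 L by (intro mult_mono add_mono power_mono) (auto intro!: add_nonneg_nonneg mult_nonneg_nonneg simp: harm_nonneg)
  also have "\<dots> = 256 * L ^ 5 * (x powr (3 - 3 * s) * x + 16 * (x powr (- (3 / 2) * s) * x ^ 3))"
    by (simp add: x_def algebra_simps eval_nat_numeral)
  also have "x powr (3 - 3 * s) * x = x powr (4 - 3 * s)"
    using x powr_add[of x "3 - 3 * s" 1] by simp
  also have "x powr (- (3 / 2) * s) * x ^ 3 = x powr (3 - (3 / 2) * s)"
    using x powr_add[of x "- (3 / 2) * s" 3] by simp
  finally have "(\<Sum>q=A..<H ^ 3. real q powr (- s) * norm (dual_sum H q) ^ 2) * x powr (- 1 - s) \<le>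
     256 * L ^ 5 * (x powr (4 - 3 * s) + 16 * x powr (3 - (3 / 2) * s)) * x powr (- 1 - s)"
    by (rule mult_right_mono) simp
  also have "\<dots> = 256 * L ^ 5 * (x powr (3 - 4 * s) + 16 * x powr (2 - (5 / 2) * s))"
  proof -
    have "x powr (4 - 3 * s) * x powr (- 1 - s) = x powr (3 - 4 * s)"
         "x powr (3 - (3 / 2) * s) * x powr (- 1 - s) = x powr (2 - (5 / 2) * s)"
      by (simp_all flip: powr_add)
    thus ?thesis by (simp only: distrib_right mult.assoc)
  qed
  also have "\<dots> \<le> 256 * L ^ 5 * (x powr (- 1 / 10) + 16 * x powr (- 1 / 10))"
    using x s L by (intro mult_left_mono add_mono powr_mono) auto
  also have "x powr (- 1 / 10) = 2 powr (- real j / 10)"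
  proof -
    have "x = 2 powr real j" by (simp add: x_def H_def powr_realpow)
    thus ?thesis by (simp add: powr_powr)
  qed
  finally show ?thesis by (simp add: A_def H_def x_def L_def)
qed

lemma summable_dyadic_bound: "summable (\<lambda>j. 4352 * (3 * real j + 5) ^ 5 * 2 powr (- real j / 10))"
proof (rule summable_comparison_test_ev)
  have "summable (\<lambda>j. ((2::real) powr (- 1 / 20)) ^ j)"
    by (rule summable_geometric) (simp add: powr_less_one)
  also have "(\<lambda>j. ((2::real) powr (- 1 / 20)) ^ j) = (\<lambda>j. 2 powr (- real j / 20))"
    by (simp add: powr_realpow[symmetric] powr_powr)
  finally show "summable (\<lambda>j. (2::real) powr (- real j / 20))" .
  have "eventually (\<lambda>j. 4352 * (3 * real j + 5) ^ 5 * 2 powr (- real j / 10) \<le> 2 powr (- real j / 20)) sequentially"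
    by real_asymp
  thus "eventually (\<lambda>j. norm (4352 * (3 * real j + 5) ^ 5 * 2 powr (- real j / 10)) \<le> 2 powr (- real j / 20)) sequentially"
    by simp
qed

text \<open>
  The scale \<open>2 ^ j\<close> stands for \<open>1 / \<psi> q\<close>: moduli \<open>q < dyadic_lower j\<close> do not occur, because
  \<open>\<psi> q \<ge> q powr (-2/3)\<close>, and for \<open>q \<ge> (2 ^ j) ^ 3\<close> the
  trivial bound for the dual sum suffices.
\<close>

definition excess :: "real \<Rightarrow> nat \<Rightarrow> nat \<Rightarrow> real" where
  "excess s j q = (if dyadic_lower j \<le> q \<and> q < (2 ^ j) ^ 3
     then real q powr (- s) * norm (dual_sum (2 ^ j) q) ^ 2 * (2 ^ j) powr (- 1 - s) else 0)"

lemma excess_nonneg: "excess s j q \<ge> 0"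
  by (simp add: excess_def)

text \<open>Only one scale j matters at a given q, but which one depends on \<psi>. Adding all
  scales removes this dependence, and after interchanging the sums each scale is a full dyadic block
  with a geometrically small bound.\<close>

lemma summable_excess:
  assumes s: "11 / 13 < s" "s \<le> 1"
  shows "summable (\<lambda>q. \<Sum>j<q. excess s j q)"
proof (rule summableI_nonneg_bounded)
  define D where "D = (\<lambda>j. 4352 * (3 * real j + 5) ^ 5 * 2 powr (- real j / 10))"
  fix N
  have "(\<Sum>q<N. \<Sum>j<q. excess s j q) \<le> (\<Sum>q<N. \<Sum>j<N. excess s j q)"
    by (intro sum_mono sum_mono2) (auto simp: excess_nonneg)
  also have "\<dots> = (\<Sum>j<N. \<Sum>q<N. excess s j q)" by (rule sum.swap)
  also have "\<dots> \<le> (\<Sum>j<N. D j)"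
  proof (rule sum_mono)
    fix j
    have "(\<Sum>q<N. excess s j q) = (\<Sum>q\<in>{q. q < N \<and> dyadic_lower j \<le> q \<and> q < (2 ^ j) ^ 3}. excess s j q)"
      by (intro sum.mono_neutral_right) (auto simp: excess_def)
    also have "\<dots> \<le> (\<Sum>q=dyadic_lower j..<(2 ^ j) ^ 3. excess s j q)"
      by (intro sum_mono2) (auto simp: excess_nonneg)
    also have "\<dots> = (\<Sum>q=dyadic_lower j..<(2 ^ j) ^ 3. real q powr (- s) * norm (dual_sum (2 ^ j) q) ^ 2) * (2 ^ j) powr (- 1 - s)"
      unfolding sum_distrib_right by (intro sum.cong) (auto simp: excess_def)
    also have "\<dots> \<le> D j" unfolding D_def by (rule dyadic_block_le[OF s])
    finally show "(\<Sum>q<N. excess s j q) \<le> D j" .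
  qed
  also have "\<dots> \<le> suminf D"
    using summable_dyadic_bound by (intro sum_le_suminf) (auto simp: D_def)
  finally show "(\<Sum>q<N. \<Sum>j<q. excess s j q) \<le> suminf D" .
qed (auto intro: sum_nonneg simp: excess_nonneg)

section \<open>Covering cost at a single modulus\<close>

definition approx_numerators :: "nat \<Rightarrow> real \<Rightarrow> nat set" where
  "approx_numerators q \<delta> = {a. a \<le> q \<and> nearest_int_dist (real a ^ 2 / real q) \<le> \<delta>}"

text \<open>The numerator a = q, which occurs for points near x = 1, is not a reduced residue below
  q. Since 0 always qualifies, the factor 2 absorbs it.\<close>

lemma card_approx_numerators_le:
  assumes "q > 0" "\<delta> \<ge> 0"
  shows "card (approx_numerators q \<delta>) \<le> 2 * card (near_square_residues q \<delta>)"
proof -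
  have fin: "finite (near_square_residues q \<delta>)" by (simp add: near_square_residues_def)
  have "0 \<in> near_square_residues q \<delta>" using assms by (simp add: near_square_residues_def nearest_int_dist_def)
  hence "card (near_square_residues q \<delta>) \<ge> 1" using fin by (metis One_nat_def Suc_leI card_gt_0_iff empty_iff)
  moreover have "card (approx_numerators q \<delta>) \<le> card (insert q (near_square_residues q \<delta>))"
    using fin by (intro card_mono) (auto simp: near_square_residues_def approx_numerators_def)
  moreover have "card (insert q (near_square_residues q \<delta>)) \<le> Suc (card (near_square_residues q \<delta>))"
    by (rule card_insert_le_m1[of "Suc _", simplified]) (auto simp: fin)
  ultimately show ?thesis by linarith
qed

text \<open>For q >= H^3 the trivial bound merges the dual sum into the expected term. Otherwise its
  contribution is one term of \<open>excess\<close>, with index j < q because 2^j = H <= q^(2/3) <=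
  q. With 1/H <= 48 \<psi>, the expected count costs 2 * 48 = 96 and the trivial bound 2 * 4 * 48 =
  384, which add up to 480.\<close>

lemma card_approx_numerators_powr_le:
  assumes s: "11 / 13 < s" "s \<le> 1" and C: "C > 0"
    and count: "\<And>H q. H > 0 \<Longrightarrow> q > 0 \<Longrightarrow>
      real (card (near_square_residues q (1 / (6 * real H)))) \<le> C * (real q + norm (dual_sum H q) ^ 2) / real H"
    and q: "q > 0" and \<psi>: "real q powr (- 2 / 3) \<le> \<psi>" "\<psi> \<le> 1 / 24"
  shows "real (card (approx_numerators q (4 * \<psi>))) * (\<psi> / real q) powr s \<le>
     480 * C * (\<psi> powr (s + 1) * real q powr (1 - s)) + 2 * C * (\<Sum>j<q. excess s j q)"
proof -
  have \<psi>0: "\<psi> > 0" using \<psi>(1) q by (auto intro: less_le_trans[rotated])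
  \<comment> \<open>Here 24 = 4 * 6: for H at most y the tolerance 4\<psi> is within the 1/(6H) of
    the Fejer count. The largest such power of two exceeds y/2, whence 1/H <= 48 \<psi>.\<close>
  define y where "y = 1 / (24 * \<psi>)"
  have y: "y \<ge> 1" using \<psi>0 \<psi>(2) by (simp add: y_def field_simps)
  define j where "j = nat \<lfloor>log 2 y\<rfloor>"
  define H :: nat where "H = 2 ^ j"
  have lg: "log 2 y \<ge> 0" using y by simp
  have Hy: "real H \<le> y" "y < 2 * real H"
  proof -
    have "real H = 2 powr real j" by (simp add: H_def powr_realpow)
    moreover have "real j \<le> log 2 y" "log 2 y < real j + 1" unfolding j_def using lg by linarith+
    ultimately show "real H \<le> y" "y < 2 * real H"
      using y by (simp_all add: le_log_iff log_less_iff powr_add)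
  qed
  have H0: "H > 0" by (simp add: H_def)
  have iH: "1 / real H \<le> 48 * \<psi>" using Hy(2) H0 \<psi>0 by (simp add: y_def field_simps)
  have \<psi>H: "4 * \<psi> \<le> 1 / (6 * real H)" "\<psi> \<le> 1 / real H"
    using Hy(1) H0 \<psi>0 by (simp_all add: y_def field_simps)
  define T where "T = norm (dual_sum H q)"
  define u where "u = \<psi> powr (s + 1) * real q powr (1 - s)"
  define P where "P = (\<psi> / real q) powr s"
  \<comment> \<open>The term of the given series is the expected number \<psi> q of numerators times
    the cost (\<psi>/q)^s of one piece.\<close>
  have u: "\<psi> * real q * P = u"
  proof -
    have "P = \<psi> powr s * real q powr (- s)" using \<psi>0 q by (simp add: P_def powr_divide powr_minus field_simps)
    thus ?thesis using \<psi>0 q by (simp add: u_def powr_add powr_diff powr_minus field_simps)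
  qed
  have P: "P \<ge> 0" "P \<le> (real H) powr (- s) * real q powr (- s)"
  proof -
    have "P \<le> (1 / real H / real q) powr s"
      unfolding P_def using \<psi>H(2) \<psi>0 s by (intro powr_mono2 divide_right_mono) auto
    also have "\<dots> = (real H) powr (- s) * real q powr (- s)"
      using H0 q by (simp add: powr_divide powr_minus powr_mult field_simps)
    finally show "P \<le> (real H) powr (- s) * real q powr (- s)" .
  qed (simp add: P_def)
  have g0: "(\<Sum>j<q. excess s j q) \<ge> 0" by (intro sum_nonneg) (auto simp: excess_nonneg)
  have "real (card (approx_numerators q (4 * \<psi>))) \<le> 2 * real (card (near_square_residues q (4 * \<psi>)))"
  proof -
    have "real (card (approx_numerators q (4 * \<psi>))) \<le> real (2 * card (near_square_residues q (4 * \<psi>)))"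
      unfolding of_nat_le_iff using card_approx_numerators_le[OF q] \<psi>0 by simp
    thus ?thesis by simp
  qed
  also have "real (card (near_square_residues q (4 * \<psi>))) \<le> real (card (near_square_residues q (1 / (6 * real H))))"
    unfolding of_nat_le_iff using \<psi>H(1) by (intro card_mono) (auto simp: near_square_residues_def)
  also have "real (card (near_square_residues q (1 / (6 * real H)))) \<le> C * (real q + T ^ 2) / real H"
    unfolding T_def using H0 q by (rule count)
  finally have n: "real (card (approx_numerators q (4 * \<psi>))) \<le> 2 * (C * (real q + T ^ 2) / real H)" by simp
  have "real (card (approx_numerators q (4 * \<psi>))) * P \<le> 2 * (C * (real q + T ^ 2) / real H) * P"
    using n P(1) by (rule mult_right_mono)
  also have "\<dots> = 2 * C * (1 / real H) * (real q * P) + 2 * C * (T ^ 2 / real H * P)"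
    by (simp add: add_divide_distrib algebra_simps)
  finally have main: "real (card (approx_numerators q (4 * \<psi>))) * P \<le>
     2 * C * (1 / real H) * (real q * P) + 2 * C * (T ^ 2 / real H * P)" .
  have first: "2 * C * (1 / real H) * (real q * P) \<le> 96 * C * u"
  proof -
    have "2 * C * (1 / real H) * (real q * P) \<le> 2 * C * (48 * \<psi>) * (real q * P)"
      using iH C P(1) by (intro mult_right_mono mult_left_mono) auto
    thus ?thesis by (simp flip: u)
  qed
  have second: "2 * C * (T ^ 2 / real H * P) \<le> 384 * C * u + 2 * C * (\<Sum>j<q. excess s j q)"
  proof (cases "H ^ 3 \<le> q")
    case True
    have "T ^ 2 \<le> 4 * real H ^ 3" unfolding T_def by (rule norm_dual_sum_square_le)
    also have "real H ^ 3 \<le> real q" using True by (simp flip: of_nat_power)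
    finally have "T ^ 2 * (1 / real H) * P \<le> (4 * real q) * (48 * \<psi>) * P"
      using iH P(1) H0 by (intro mult_right_mono mult_mono) auto
    also have "\<dots> = 192 * u" by (simp flip: u)
    finally have "2 * C * (T ^ 2 / real H * P) \<le> 2 * C * (192 * u)" using C by (intro mult_left_mono) auto
    thus ?thesis using g0 C by (simp add: add_increasing2)
  next
    case False
    have Hq: "real H \<le> real q powr (2 / 3)"
    proof -
      have "real H \<le> 1 / \<psi>" using Hy(1) \<psi>0 by (simp add: y_def field_simps)
      also have "\<dots> \<le> 1 / real q powr (- 2 / 3)" using \<psi>(1) \<psi>0 q by (intro divide_left_mono) auto
      also have "\<dots> = real q powr (2 / 3)" by (simp add: powr_minus field_simps)
      finally show ?thesis .
    qed
    have "real H powr (3 / 2) \<le> (real q powr (2 / 3)) powr (3 / 2)" using Hq by (intro powr_mono2) auto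
    hence "real H powr (3 / 2) \<le> real q" using q by (simp add: powr_powr)
    hence low: "dyadic_lower j \<le> q" unfolding dyadic_lower_def H_def by (simp add: nat_le_iff ceiling_le_iff)
    have "real q powr (2 / 3) \<le> real q powr 1" using q by (intro powr_mono) auto
    hence "real H \<le> real q" using Hq q by simp
    hence "H \<le> q" by (simp only: of_nat_le_iff)
    hence "j < q" using less_exp[of j] unfolding H_def by linarith
    have "T ^ 2 / real H * P \<le> T ^ 2 / real H * ((real H) powr (- s) * real q powr (- s))"
      using P(2) by (intro mult_left_mono) auto
    also have "\<dots> = real q powr (- s) * T ^ 2 * real H powr (- 1 - s)"
      using H0 by (simp add: powr_diff powr_minus field_simps)
    also have "\<dots> = excess s j q"
      using low False by (simp add: excess_def T_def H_def)
    also have "\<dots> \<le> (\<Sum>j<q. excess s j q)"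
      using \<open>j < q\<close> by (intro member_le_sum) (auto simp: excess_nonneg)
    finally have "2 * C * (T ^ 2 / real H * P) \<le> 2 * C * (\<Sum>j<q. excess s j q)"
      using C by (intro mult_left_mono) auto
    moreover have "384 * C * u \<ge> 0" using C by (simp add: u_def)
    ultimately show ?thesis by linarith
  qed
  show ?thesis using main first second unfolding P_def[symmetric] u_def[symmetric] by linarith
qed

section \<open>Hausdorff measure of limsup sets\<close>

text \<open>Hausdorff-Cantelli: every tail of the family covers E, at a cost bounded by a tail of
  the series. That the pieces become small is read off from the same series: for nonempty
  \<open>F q\<close>, \<open>d q powr s\<close> is at most its q-th term, which tends to 0.\<close>

lemma hausdorff_measure_limsup_eq_0:
  fixes B :: "nat \<Rightarrow> nat \<Rightarrow> 'a::metric_space set" and d :: "nat \<Rightarrow> real"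
  assumes s: "s > 0"
    and F: "\<And>q. finite (F q)" and d: "\<And>q. d q \<ge> 0"
    and B: "\<And>q a. a \<in> F q \<Longrightarrow> bounded (B q a) \<and> diameter (B q a) \<le> d q"
    and sum: "summable (\<lambda>q. real (card (F q)) * d q powr s)"
    and E: "\<And>z. z \<in> E \<Longrightarrow> infinite {q. \<exists>a\<in>F q. z \<in> B q a}"
  shows "hausdorff_measure s E = 0"
proof -
  define f where "f = (\<lambda>q. real (card (F q)) * d q powr s)"
  have f0: "f q \<ge> 0" for q by (simp add: f_def)
  have "hausdorff_premeasure s \<delta> E \<le> 0" if \<delta>: "\<delta> > 0" for \<delta>
  proof (rule ennreal_le_epsilon)
    fix \<epsilon> :: real assume \<epsilon>: "\<epsilon> > 0"
    have "f \<longlonglongrightarrow> 0" using sum unfolding f_def by (rule summable_LIMSEQ_zero)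
    hence ev1: "eventually (\<lambda>q. f q < \<delta> powr s) sequentially"
      by (rule order_tendstoD) (use \<delta> in simp)
    then obtain Q1 where Q1: "\<And>q. q \<ge> Q1 \<Longrightarrow> f q < \<delta> powr s"
      by (auto simp: eventually_sequentially)
    obtain Q2 where Q2: "\<And>n. n \<ge> Q2 \<Longrightarrow> norm (\<Sum>i. f (i + n)) < \<epsilon>"
      using suminf_exist_split[OF \<epsilon>, of f] sum by (auto simp: f_def)
    define Q where "Q = max Q1 Q2"
    define V where "V = (\<lambda>(i, a). if a \<in> F (i + Q) then B (i + Q) a else {})"
    have V: "bounded (V p) \<and> diameter (V p) \<le> \<delta>" for p
    proof (cases p)
      case (Pair i a)
      show ?thesis
      proof (cases "a \<in> F (i + Q)")
        case True
        hence "card (F (i + Q)) \<ge> 1" using F by (metis One_nat_def Suc_leI card_gt_0_iff empty_iff)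
        hence "1 * d (i + Q) powr s \<le> f (i + Q)" unfolding f_def by (intro mult_right_mono) auto
        also have "\<dots> < \<delta> powr s" by (rule Q1) (simp add: Q_def)
        finally have "d (i + Q) < \<delta>" using s \<delta> d powr_less_cancel2[of s "d (i + Q)" \<delta>] 
          by (metis mult_1 powr_mono2 not_less less_imp_le)
        thus ?thesis using B[OF True] Pair True by (auto simp: V_def)
      qed (use Pair \<delta> in \<open>auto simp: V_def\<close>)
    qed
    have cover: "E \<subseteq> (\<Union>n. V (prod_decode n))"
    proof
      fix z assume "z \<in> E"
      from E[OF this] obtain q where "q \<ge> Q" "\<exists>a\<in>F q. z \<in> B q a"
        unfolding infinite_nat_iff_unbounded_le by blast
      then obtain a i where "q = i + Q" "a \<in> F q" "z \<in> B q a" by (metis add.commute le_Suc_ex)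
      hence "z \<in> V (prod_decode (prod_encode (i, a)))" by (simp add: V_def)
      thus "z \<in> (\<Union>n. V (prod_decode n))" by blast
    qed
    have row: "(\<Sum>a. diam_pow s (V (i, a))) \<le> ennreal (f (i + Q))" for i
    proof -
      have "(\<Sum>a. diam_pow s (V (i, a))) = (\<Sum>a\<in>F (i + Q). diam_pow s (V (i, a)))"
        by (rule suminf_finite) (auto simp: F V_def diam_pow_def)
      also have "\<dots> \<le> (\<Sum>a\<in>F (i + Q). ennreal (d (i + Q) powr s))"
      proof (rule sum_mono)
        fix a assume a: "a \<in> F (i + Q)"
        have "diameter (B (i + Q) a) \<ge> 0" using B[OF a] by (intro diameter_ge_0) auto
        thus "diam_pow s (V (i, a)) \<le> ennreal (d (i + Q) powr s)"
          using a s B[OF a] by (auto simp: diam_pow_def V_def intro!: ennreal_leI powr_mono2)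
      qed
      also have "\<dots> = ennreal (f (i + Q))"
        by (simp add: f_def ennreal_mult ennreal_of_nat_eq_real_of_nat)
      finally show ?thesis .
    qed
    have "hausdorff_premeasure s \<delta> E \<le> (\<Sum>n. diam_pow s (V (prod_decode n)))"
      unfolding hausdorff_premeasure_def
      by (rule INF_lower2[of "\<lambda>n. V (prod_decode n)"]) (use cover V in auto)
    also have "\<dots> = (\<Sum>i. \<Sum>a. diam_pow s (V (i, a)))"
      by (rule suminf_ennreal_2dimen) simp
    also have "\<dots> \<le> (\<Sum>i. ennreal (f (i + Q)))"
      by (rule suminf_le[OF row]) auto
    also have "\<dots> = ennreal (\<Sum>i. f (i + Q))"
    proof (intro suminf_ennreal_eq summable_sums)
      show "summable (\<lambda>i. f (i + Q))" unfolding summable_iff_shift using sum by (simp add: f_def)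
    qed (rule f0)
    also have "\<dots> \<le> ennreal \<epsilon>" using Q2[of Q] by (intro ennreal_leI) (auto simp: Q_def)
    finally show "hausdorff_premeasure s \<delta> E \<le> 0 + ennreal \<epsilon>" by simp
  qed
  hence "hausdorff_premeasure s \<delta> E = 0" if "\<delta> > 0" for \<delta> using that by simp
  thus ?thesis unfolding hausdorff_measure_def by (simp add: SUP_eq_const)
qed

section \<open>Covering the parabola by arcs near rational abscissae\<close>

definition parabola_piece :: "nat \<Rightarrow> nat \<Rightarrow> real \<Rightarrow> (real ^ 2) set" where
  "parabola_piece q a \<delta> = {vector [x, x\<^sup>2] | x. x \<in> {0..1} \<and> \<bar>real q * x - real a\<bar> \<le> \<delta>}"

text \<open>Abscissae differ by at most 2\<delta>/q and ordinates by at most twice that, as |x + y|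
  <= 2; the sum of both gives the factor 6.\<close>

lemma parabola_piece_diameter:
  assumes "q > 0" "\<delta> \<ge> 0"
  shows "bounded (parabola_piece q a \<delta>) \<and> diameter (parabola_piece q a \<delta>) \<le> 6 * \<delta> / real q"
proof -
  have dist: "dist z w \<le> 6 * \<delta> / real q" if zw: "z \<in> parabola_piece q a \<delta>" "w \<in> parabola_piece q a \<delta>" for z w
  proof -
    obtain x y where x: "z = vector [x, x\<^sup>2]" "x \<in> {0..1}" "\<bar>real q * x - real a\<bar> \<le> \<delta>"
      and y: "w = vector [y, y\<^sup>2]" "y \<in> {0..1}" "\<bar>real q * y - real a\<bar> \<le> \<delta>"
      using zw by (auto simp: parabola_piece_def)
    have "real q * \<bar>x - y\<bar> = \<bar>real q * x - real q * y\<bar>" by (simp add: abs_mult flip: right_diff_distrib)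
    also have "\<dots> \<le> 2 * \<delta>" using x(3) y(3) by linarith
    finally have xy: "\<bar>x - y\<bar> \<le> 2 * \<delta> / real q" using assms by (simp add: field_simps)
    have "norm (z - w) \<le> (\<Sum>i\<in>UNIV. \<bar>(z - w) $ i\<bar>)" by (rule norm_le_l1_cart)
    also have "\<dots> = \<bar>x - y\<bar> + \<bar>x\<^sup>2 - y\<^sup>2\<bar>" by (simp add: UNIV_2 x y)
    also have "\<bar>x\<^sup>2 - y\<^sup>2\<bar> = \<bar>x - y\<bar> * \<bar>x + y\<bar>" by (simp add: power2_eq_square square_diff_square_factored abs_mult)
    also have "\<dots> \<le> \<bar>x - y\<bar> * 2" using x y by (intro mult_left_mono) auto
    finally show ?thesis using xy by (simp add: dist_norm)
  qed
  have "bounded (parabola_piece q a \<delta>)"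
    unfolding bounded_two_points using dist by blast
  moreover have "diameter (parabola_piece q a \<delta>) \<le> 6 * \<delta> / real q"
    using dist assms by (intro diameter_le) (auto simp: dist_norm)
  ultimately show ?thesis by simp
qed

lemma nearest_int_dist_le: "nearest_int_dist x \<le> \<bar>x - of_int m\<bar>"
  unfolding nearest_int_dist_def using round_diff_minimal[of x m] by (simp add: abs_minus_commute)

text \<open>Let a be the integer nearest to q x. Then a^2/q - q x^2 = (a - q x)(a + q x)/q is at
  most 2\<psi> in absolute value, because a and q x are at most q. Together with the condition on
  the second coordinate, a^2/q lies within 3\<psi>, hence within 4\<psi>', of an integer.\<close>

lemma simult_approx_parabola_cover:
  assumes z: "z \<in> simult_approx \<psi> \<inter> parabola_arc"
    and le: "\<And>q. q \<ge> 1 \<Longrightarrow> \<psi> q \<le> \<psi>' q"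
  shows "infinite {q. \<exists>a\<in>(if q = 0 then {} else approx_numerators q (4 * \<psi>' q)). z \<in> parabola_piece q a (\<psi>' q)}"
proof -
  obtain x where x: "z = vector [x, x\<^sup>2]" "x \<in> {0..1}" using z by (auto simp: parabola_arc_def)
  have "infinite {q. q \<ge> 1 \<and> (MAX i\<in>UNIV. nearest_int_dist (real q * z $ i)) < \<psi> q}"
    using z by (simp add: simult_approx_def)
  moreover have "{q. q \<ge> 1 \<and> (MAX i\<in>UNIV. nearest_int_dist (real q * z $ i)) < \<psi> q} \<subseteq>
     {q. \<exists>a\<in>(if q = 0 then {} else approx_numerators q (4 * \<psi>' q)). z \<in> parabola_piece q a (\<psi>' q)}"
  proof safe
    fix q :: nat assume q: "q \<ge> 1" and max: "(MAX i\<in>UNIV. nearest_int_dist (real q * z $ i)) < \<psi> q"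
    have nid: "nearest_int_dist (real q * z $ i) < \<psi> q" for i
      using max by (subst (asm) Max_less_iff) auto
    have n1: "nearest_int_dist (real q * x) < \<psi> q" and n2: "nearest_int_dist (real q * x\<^sup>2) < \<psi> q"
      using nid[of 1] nid[of 2] by (simp_all add: x)
    define a where "a = nat (round (real q * x))"
    have r0: "round (real q * x) \<ge> 0" using x(2) round_mono[of 0 "real q * x"] by simp
    have "real q * x \<le> real q" using x(2) by (simp add: mult_left_le)
    hence "round (real q * x) \<le> int q" using round_mono[of "real q * x" "real q"] by simp
    hence aq: "a \<le> q" using r0 by (simp add: a_def nat_le_iff)
    have ax: "\<bar>real q * x - real a\<bar> < \<psi> q" using n1 r0 by (simp add: nearest_int_dist_def a_def)
    have "nearest_int_dist (real a ^ 2 / real q) \<le> \<bar>real a ^ 2 / real q - of_int (round (real q * x\<^sup>2))\<bar>"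
      by (rule nearest_int_dist_le)
    also have "\<dots> \<le> \<bar>real a ^ 2 / real q - real q * x\<^sup>2\<bar> + \<bar>real q * x\<^sup>2 - of_int (round (real q * x\<^sup>2))\<bar>"
      by linarith
    also have "\<bar>real q * x\<^sup>2 - of_int (round (real q * x\<^sup>2))\<bar> \<le> \<psi> q" using n2 by (simp add: nearest_int_dist_def)
    also have "\<bar>real a ^ 2 / real q - real q * x\<^sup>2\<bar> \<le> 2 * \<psi> q"
    proof -
      have "real a ^ 2 / real q - real q * x\<^sup>2 = (real a - real q * x) * ((real a + real q * x) / real q)"
        using q by (simp add: field_simps power2_eq_square)
      hence "\<bar>real a ^ 2 / real q - real q * x\<^sup>2\<bar> = \<bar>real q * x - real a\<bar> * \<bar>(real a + real q * x) / real q\<bar>"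
        by (simp add: abs_mult abs_minus_commute)
      also have "\<dots> \<le> \<psi> q * 2"
      proof (intro mult_mono)
        show "\<bar>(real a + real q * x) / real q\<bar> \<le> 2"
        proof -
          have "real a \<le> real q" "0 \<le> real q * x" using aq x(2) by auto
          hence "\<bar>real a + real q * x\<bar> \<le> 2 * real q" using \<open>real q * x \<le> real q\<close> by linarith
          thus ?thesis using q by (simp add: field_simps)
        qed
      qed (use ax in auto)
      finally show ?thesis by simp
    qed
    finally have "nearest_int_dist (real a ^ 2 / real q) \<le> 4 * \<psi>' q" using le[OF q] ax by linarith
    hence "a \<in> approx_numerators q (4 * \<psi>' q)" using aq by (simp add: approx_numerators_def)
    moreover have "z \<in> parabola_piece q a (\<psi>' q)"
      using x ax le[OF q] by (force simp: parabola_piece_def)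
    ultimately show "\<exists>a\<in>(if q = 0 then {} else approx_numerators q (4 * \<psi>' q)). z \<in> parabola_piece q a (\<psi>' q)"
      using q by auto
  qed
  ultimately show ?thesis using finite_subset by blast
qed

theorem theorem2:
  fixes s :: real and \<psi> :: "nat \<Rightarrow> real"
  assumes "s \<in> {11/13<..1}"
    and "\<And>q. q \<ge> 1 \<Longrightarrow> \<psi> q \<ge> 0"
    and "(\<lambda>q. \<psi> q powr (s + 1) * real q powr (1 - s)) summable_on {1..}"
  shows "hausdorff_measure s (simult_approx \<psi> \<inter> parabola_arc) = 0"
proof -
  have s: "11 / 13 < s" "s \<le> 1" using assms(1) by auto
  \<comment> \<open>Enlarging \<psi> keeps the cover valid and holds the scale 1/\<psi>' at most
    q^(2/3), as the count requires.\<close>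
  define \<psi>' where "\<psi>' = (\<lambda>q. max (\<psi> q) (real q powr (- 2 / 3)))"
  define u where "u = (\<lambda>q. \<psi>' q powr (s + 1) * real q powr (1 - s))"
  define n where "n = (\<lambda>q. real (card (approx_numerators q (4 * \<psi>' q))))"
  have \<psi>'0: "\<psi>' q \<ge> 0" for q by (simp add: \<psi>'_def le_max_iff_disj)
  have sum_\<psi>: "summable (\<lambda>q. \<psi> q powr (s + 1) * real q powr (1 - s))"
  proof -
    \<comment> \<open>The index 0 may be added since \<open>0 powr (1 - s) = 0\<close>, also when s
      = 1.\<close>
    have "(\<lambda>q. \<psi> q powr (s + 1) * real q powr (1 - s)) summable_on UNIV"
      using assms(3) by (rule summable_on_cong_neutral[THEN iffD1, rotated -1]) (auto simp: not_le)
    thus ?thesis by (simp add: summable_on_UNIV_nonneg_real_iff)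
  qed
  \<comment> \<open>The exponent is (1 - 5s)/3, which is below -1 for s > 4/5.\<close>
  have sum_q: "summable (\<lambda>q. real q powr (- 2 / 3 * (s + 1) + (1 - s)))"
    unfolding summable_real_powr_iff using s by (simp add: field_simps)
  have sum_u: "summable u"
  proof (rule summable_comparison_test)
    show "\<exists>N. \<forall>q\<ge>N. norm (u q) \<le> \<psi> q powr (s + 1) * real q powr (1 - s) + real q powr (- 2 / 3 * (s + 1) + (1 - s))"
    proof (intro exI allI impI)
      fix q :: nat assume q: "q \<ge> 1"
      have "\<psi>' q powr (s + 1) \<le> \<psi> q powr (s + 1) + (real q powr (- 2 / 3)) powr (s + 1)"
        by (auto simp: \<psi>'_def max_def)
      hence "u q \<le> (\<psi> q powr (s + 1) + (real q powr (- 2 / 3)) powr (s + 1)) * real q powr (1 - s)"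
        unfolding u_def by (rule mult_right_mono) simp
      also have "\<dots> = \<psi> q powr (s + 1) * real q powr (1 - s) + real q powr (- 2 / 3 * (s + 1) + (1 - s))"
        by (simp only: distrib_right[of "\<psi> q powr (s + 1)"] powr_powr powr_add[of _ "- 2 / 3 * (s + 1)"])
      finally show "norm (u q) \<le> \<psi> q powr (s + 1) * real q powr (1 - s) + real q powr (- 2 / 3 * (s + 1) + (1 - s))"
        by (simp add: u_def)
    qed
  qed (intro summable_add sum_\<psi> sum_q)
  obtain C where C: "C > 0" and count: "\<And>H q. H > 0 \<Longrightarrow> q > 0 \<Longrightarrow>
      real (card (near_square_residues q (1 / (6 * real H)))) \<le> C * (real q + norm (dual_sum H q) ^ 2) / real H"
    using card_near_square_residues_le by blast
  \<comment> \<open>For q >= 1 the factor q^(1-s) is at least 1 because s <= 1, so convergence of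
    the series forces \<psi>' to 0. The threshold 1/24 makes the scale H at least 1.\<close>
  have small: "eventually (\<lambda>q. \<psi>' q \<le> 1 / 24) sequentially"
  proof -
    have "eventually (\<lambda>q. u q < (1 / 24) powr (s + 1)) sequentially"
      by (rule order_tendstoD[OF summable_LIMSEQ_zero[OF sum_u]]) simp
    thus ?thesis using eventually_ge_at_top[of 1]
    proof eventually_elim
      case (elim q)
      show ?case
      proof (rule ccontr)
        assume "\<not> \<psi>' q \<le> 1 / 24"
        hence "(1 / 24) powr (s + 1) \<le> \<psi>' q powr (s + 1)" using s by (intro powr_mono2) auto
        also have "\<dots> * 1 \<le> u q"
          unfolding u_def using elim s by (intro mult_left_mono ge_one_powr_ge_zero) auto
        finally show False using elim by simp
      qed
    qed
  qed
  have sum_n: "summable (\<lambda>q. n q * (\<psi>' q / real q) powr s)"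
  proof (rule summable_comparison_test_ev)
    show "eventually (\<lambda>q. norm (n q * (\<psi>' q / real q) powr s) \<le> 480 * C * u q + 2 * C * (\<Sum>j<q. excess s j q)) sequentially"
      using small eventually_ge_at_top[of 1]
    proof eventually_elim
      case (elim q)
      have "n q * (\<psi>' q / real q) powr s \<le> 480 * C * u q + 2 * C * (\<Sum>j<q. excess s j q)"
        unfolding n_def u_def using elim
        by (intro card_approx_numerators_powr_le s C count) (auto simp: \<psi>'_def)
      thus ?case by (simp add: n_def)
    qed
    show "summable (\<lambda>q. 480 * C * u q + 2 * C * (\<Sum>j<q. excess s j q))"
      by (intro summable_add summable_mult sum_u summable_excess s)
  qed
  show ?thesis
  proof (rule hausdorff_measure_limsup_eq_0)
    show "s > 0" using s by simp
    show "finite (if q = 0 then {} else approx_numerators q (4 * \<psi>' q))" for q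
      by (simp add: approx_numerators_def)
    show "6 * \<psi>' q / real q \<ge> 0" for q using \<psi>'0 by simp
    show "bounded (parabola_piece q a (\<psi>' q)) \<and> diameter (parabola_piece q a (\<psi>' q)) \<le> 6 * \<psi>' q / real q"
      if "a \<in> (if q = 0 then {} else approx_numerators q (4 * \<psi>' q))" for q a
      using that \<psi>'0 by (intro parabola_piece_diameter) (auto split: if_splits)
    show "summable (\<lambda>q. real (card (if q = 0 then {} else approx_numerators q (4 * \<psi>' q))) * (6 * \<psi>' q / real q) powr s)"
    proof (rule summable_comparison_test)
      show "summable (\<lambda>q. 6 powr s * (n q * (\<psi>' q / real q) powr s))"
        by (intro summable_mult sum_n)
      have "(6 * \<psi>' q / real q) powr s = 6 powr s * (\<psi>' q / real q) powr s" for q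
        using powr_mult[of 6 "\<psi>' q / real q" s] \<psi>'0[of q] by simp
      thus "\<exists>N. \<forall>q\<ge>N. norm (real (card (if q = 0 then {} else approx_numerators q (4 * \<psi>' q))) * (6 * \<psi>' q / real q) powr s)
        \<le> 6 powr s * (n q * (\<psi>' q / real q) powr s)"
        by (auto simp: n_def)
    qed
    show "infinite {q. \<exists>a\<in>(if q = 0 then {} else approx_numerators q (4 * \<psi>' q)). z \<in> parabola_piece q a (\<psi>' q)}"
      if "z \<in> simult_approx \<psi> \<inter> parabola_arc" for z
      using that by (rule simult_approx_parabola_cover) (simp add: \<psi>'_def)
  qed
qed

end
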